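(* $\mathbb{WNP}$ is a suboperad of $(\mathbb P,\bullet)$. It is generated by $m\in\mathbb P_{\{1,2\}}$, the two-element antichain on $\{1,2\}$, and $\downarrow\,\in\mathbb P_{\{1,2\}}$, the chain $1<2$, and the relations $$m^{(12)}=m,\qquad m\bullet_1m=m\bullet_2m,\qquad \downarrow\bullet_1\downarrow\;=\;\downarrow\bullet_2\downarrow,$$ that is, $\mathbb{WNP}$ is presented, as an operad, by these generators and relations.
   Context: Fix a base field. $\mathbb P$ is the linear species of finite nonempty posets: $\mathbb P_A$ is the vector space freely generated by all partial orders on the finite nonempty set $A$, with bijections acting by relabelling. $(\mathbb P,\bullet)$ is the operad whose partial compositions are, for posets $\mathcal A=(A,\le_A)$, $\mathcal B=(B,\le_B)$ with $A\cap B=\emptyset$ and $a\in A$: $\mathcal A\bullet_a\mathcal B$ is the set $(A\setminus\{a\})\sqcup B$ with $x\le y$ iff ($x,y\in B$, $x\le_By$) or ($x,y\in A\setminus\{a\}$, $x\le_Ay$) or ($x\in A\setminus\{a\}$, $y\in B$, $x\le_Aa$) or ($x\in B$, $y\in A\setminus\{a\}$, $a\le_Ay$). The units are the one-point posets. For elements with label sets $\{1,\dots,p\}$ and $\{1,\dots,q\}$, $f\bullet_ig$ is understood with the usual relabelling onto $\{1,\dots,p+q-1\}$ (labels of $g$ shifted by $i-1$, labels $j>i$ of $f$ shifted by $q-1$). $m^{(12)}$ is the image of $m$ under exchanging labels $1$ and $2$. A finite poset is WN ("without N") if it contains no subposet (subset with induced order) isomorphic to the four-element poset $\{x,y,z,t\}$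 whose only strict relations are $x<z$, $y<z$, $y<t$. $\mathbb{WNP}_A\subseteq\mathbb P_A$ is the subspace generated by the WN posets on $A$. *)

theory Defs
  imports Complex_Main "HOL-Library.Poly_Mapping" "HOL-Combinatorics.Transposition"
begin

section \<open>Linear operads in species form\<close>

text \<open>
  Label sets are the finite nonempty sets of natural numbers.  Every finite set is in bijection
  with one of them, so a species, or an operad, is determined by its values on these sets.
\<close>

abbreviation label_set :: "nat set \<Rightarrow> bool" where
  "label_set A \<equiv> finite A \<and> A \<noteq> {}"

text \<open>
  A species \<open>A \<mapsto> comps A\<close> has all its values inside one ambient vector space.  The map
  \<open>relabel A \<sigma>\<close> is the action of the bijection \<open>A \<rightarrow> \<sigma> ` A\<close> induced by a \<open>\<sigma>\<close> that is injective on
  \<open>A\<close>, and \<open>pcomp A B a\<close> is the partial composition at \<open>a \<in> A\<close> of an element over \<open>A\<close> with an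
  element over \<open>B\<close>, where \<open>A \<inter> B = {}\<close>.  Their values outside of \<open>comps\<close>
  are irrelevant.
\<close>

record ('k, 'v) operad_data =
  comps :: "nat set \<Rightarrow> 'v set"
  scale :: "'k \<Rightarrow> 'v \<Rightarrow> 'v"
  relabel :: "nat set \<Rightarrow> (nat \<Rightarrow> nat) \<Rightarrow> 'v \<Rightarrow> 'v"
  pcomp :: "nat set \<Rightarrow> nat set \<Rightarrow> nat \<Rightarrow> 'v \<Rightarrow> 'v \<Rightarrow> 'v"
  op_unit :: "nat \<Rightarrow> 'v"

definition linear_from ::
    "'v set \<Rightarrow> ('k \<Rightarrow> 'v \<Rightarrow> 'v) \<Rightarrow> ('k \<Rightarrow> 'w \<Rightarrow> 'w) \<Rightarrow> ('v::ab_group_add \<Rightarrow> 'w::ab_group_add) \<Rightarrow> bool" where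
  "linear_from V s s' f \<longleftrightarrow>
     (\<forall>x\<in>V. \<forall>y\<in>V. f (x + y) = f x + f y) \<and> (\<forall>c. \<forall>x\<in>V. f (s c x) = s' c (f x))"

locale operad =
  fixes P :: "('k::field, 'v::ab_group_add) operad_data"
  assumes vector_space: "vector_space (scale P)"
    and subspace: "label_set A \<Longrightarrow> module.subspace (scale P) (comps P A)"
    and relabel_closed: "label_set A \<Longrightarrow> inj_on \<sigma> A \<Longrightarrow> x \<in> comps P A \<Longrightarrow>
      relabel P A \<sigma> x \<in> comps P (\<sigma> ` A)"
    and relabel_linear: "label_set A \<Longrightarrow> inj_on \<sigma> A \<Longrightarrow>
      linear_from (comps P A) (scale P) (scale P) (relabel P A \<sigma>)"
    and relabel_cong: "label_set A \<Longrightarrow> inj_on \<sigma> A \<Longrightarrow> x \<in> comps P A \<Longrightarrow>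
      (\<And>a. a \<in> A \<Longrightarrow> \<sigma> a = \<tau> a) \<Longrightarrow> relabel P A \<sigma> x = relabel P A \<tau> x"
    and relabel_id: "label_set A \<Longrightarrow> x \<in> comps P A \<Longrightarrow> relabel P A id x = x"
    and relabel_comp: "label_set A \<Longrightarrow> inj_on \<sigma> A \<Longrightarrow> inj_on \<tau> (\<sigma> ` A) \<Longrightarrow> x \<in> comps P A \<Longrightarrow>
      relabel P A (\<tau> \<circ> \<sigma>) x = relabel P (\<sigma> ` A) \<tau> (relabel P A \<sigma> x)"
    and unit_closed: "op_unit P a \<in> comps P {a}"
    and relabel_unit: "relabel P {a} \<sigma> (op_unit P a) = op_unit P (\<sigma> a)"
    and pcomp_closed: "label_set A \<Longrightarrow> label_set B \<Longrightarrow> A \<inter> B = {} \<Longrightarrow> a \<in> A \<Longrightarrow>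
      x \<in> comps P A \<Longrightarrow> y \<in> comps P B \<Longrightarrow> pcomp P A B a x y \<in> comps P ((A - {a}) \<union> B)"
    and pcomp_linear_left: "label_set A \<Longrightarrow> label_set B \<Longrightarrow> A \<inter> B = {} \<Longrightarrow> a \<in> A \<Longrightarrow>
      y \<in> comps P B \<Longrightarrow> linear_from (comps P A) (scale P) (scale P) (\<lambda>x. pcomp P A B a x y)"
    and pcomp_linear_right: "label_set A \<Longrightarrow> label_set B \<Longrightarrow> A \<inter> B = {} \<Longrightarrow> a \<in> A \<Longrightarrow>
      x \<in> comps P A \<Longrightarrow> linear_from (comps P B) (scale P) (scale P) (pcomp P A B a x)"
    and relabel_pcomp: "label_set A \<Longrightarrow> label_set B \<Longrightarrow> A \<inter> B = {} \<Longrightarrow> a \<in> A \<Longrightarrow>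
      inj_on \<sigma> (A \<union> B) \<Longrightarrow> x \<in> comps P A \<Longrightarrow> y \<in> comps P B \<Longrightarrow>
      relabel P ((A - {a}) \<union> B) \<sigma> (pcomp P A B a x y) =
      pcomp P (\<sigma> ` A) (\<sigma> ` B) (\<sigma> a) (relabel P A \<sigma> x) (relabel P B \<sigma> y)"
    and pcomp_unit_left: "label_set B \<Longrightarrow> b \<notin> B \<Longrightarrow> y \<in> comps P B \<Longrightarrow>
      pcomp P {b} B b (op_unit P b) y = y"
    and pcomp_unit_right: "label_set A \<Longrightarrow> a \<in> A \<Longrightarrow> b \<notin> A \<Longrightarrow> x \<in> comps P A \<Longrightarrow>
      pcomp P A {b} a x (op_unit P b) = relabel P A (id(a := b)) x"
    and pcomp_sequential: "label_set A \<Longrightarrow> label_set B \<Longrightarrow> label_set C \<Longrightarrow>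
      A \<inter> B = {} \<Longrightarrow> A \<inter> C = {} \<Longrightarrow> B \<inter> C = {} \<Longrightarrow> a \<in> A \<Longrightarrow> b \<in> B \<Longrightarrow>
      x \<in> comps P A \<Longrightarrow> y \<in> comps P B \<Longrightarrow> z \<in> comps P C \<Longrightarrow>
      pcomp P ((A - {a}) \<union> B) C b (pcomp P A B a x y) z =
      pcomp P A ((B - {b}) \<union> C) a x (pcomp P B C b y z)"
    and pcomp_parallel: "label_set A \<Longrightarrow> label_set B \<Longrightarrow> label_set C \<Longrightarrow>
      A \<inter> B = {} \<Longrightarrow> A \<inter> C = {} \<Longrightarrow> B \<inter> C = {} \<Longrightarrow> a \<in> A \<Longrightarrow> a' \<in> A \<Longrightarrow> a \<noteq> a' \<Longrightarrow>
      x \<in> comps P A \<Longrightarrow> y \<in> comps P B \<Longrightarrow> z \<in> comps P C \<Longrightarrow>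
      pcomp P ((A - {a}) \<union> B) C a' (pcomp P A B a x y) z =
      pcomp P ((A - {a'}) \<union> C) B a (pcomp P A C a' x z) y"

text \<open>
  The composition \<open>f \<bullet>\<^sub>i g\<close> for \<open>f\<close> over \<open>{1..p}\<close> and \<open>g\<close> over \<open>{1..q}\<close>, with result over
  \<open>{1..p + q - 1}\<close>.  The label \<open>i\<close> of \<open>f\<close> is renamed to \<open>0\<close> to make the label sets disjoint.
\<close>

definition std_pcomp :: "('k, 'v) operad_data \<Rightarrow> nat \<Rightarrow> nat \<Rightarrow> nat \<Rightarrow> 'v \<Rightarrow> 'v \<Rightarrow> 'v" where
  "std_pcomp P p q i f g =
     (let \<alpha> = (\<lambda>j. if j < i then j else if j = i then 0 else j + q - 1);
          \<beta> = (\<lambda>j. j + i - 1)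
      in pcomp P (\<alpha> ` {1..p}) (\<beta> ` {1..q}) 0 (relabel P {1..p} \<alpha> f) (relabel P {1..q} \<beta> g))"

definition suboperad :: "('k::field, 'v::ab_group_add) operad_data \<Rightarrow> (nat set \<Rightarrow> 'v set) \<Rightarrow> bool" where
  "suboperad P S \<longleftrightarrow> operad P \<and>
     (\<forall>A. label_set A \<longrightarrow> S A \<subseteq> comps P A \<and> module.subspace (scale P) (S A)) \<and>
     (\<forall>A \<sigma>. label_set A \<and> inj_on \<sigma> A \<longrightarrow> (\<forall>x\<in>S A. relabel P A \<sigma> x \<in> S (\<sigma> ` A))) \<and>
     (\<forall>a. op_unit P a \<in> S {a}) \<and>
     (\<forall>A B a. label_set A \<and> label_set B \<and> A \<inter> B = {} \<and> a \<in> A \<longrightarrow>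
        (\<forall>x\<in>S A. \<forall>y\<in>S B. pcomp P A B a x y \<in> S ((A - {a}) \<union> B)))"

definition operad_ideal :: "('k::field, 'v::ab_group_add) operad_data \<Rightarrow> (nat set \<Rightarrow> 'v set) \<Rightarrow> bool" where
  "operad_ideal P I \<longleftrightarrow>
     (\<forall>A. label_set A \<longrightarrow> I A \<subseteq> comps P A \<and> module.subspace (scale P) (I A)) \<and>
     (\<forall>A \<sigma>. label_set A \<and> inj_on \<sigma> A \<longrightarrow> (\<forall>x\<in>I A. relabel P A \<sigma> x \<in> I (\<sigma> ` A))) \<and>
     (\<forall>A B a. label_set A \<and> label_set B \<and> A \<inter> B = {} \<and> a \<in> A \<longrightarrow>
        (\<forall>x\<in>I A. \<forall>y\<in>comps P B. pcomp P A B a x y \<in> I ((A - {a}) \<union> B)) \<and>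
        (\<forall>x\<in>comps P A. \<forall>y\<in>I B. pcomp P A B a x y \<in> I ((A - {a}) \<union> B)))"

text \<open>A pair \<open>(A, x)\<close> in \<open>R\<close> stands for an element \<open>x\<close> of \<open>comps P A\<close>.\<close>

definition generated_ideal ::
    "('k::field, 'v::ab_group_add) operad_data \<Rightarrow> (nat set \<times> 'v) set \<Rightarrow> nat set \<Rightarrow> 'v set" where
  "generated_ideal P R A = \<Inter> {I A | I. operad_ideal P I \<and> (\<forall>(B, x) \<in> R. x \<in> I B)}"

definition operad_hom :: "('k::field, 'v::ab_group_add) operad_data \<Rightarrow>
    ('k, 'w::ab_group_add) operad_data \<Rightarrow> (nat set \<Rightarrow> 'v \<Rightarrow> 'w) \<Rightarrow> bool" where
  "operad_hom P Q \<phi> \<longleftrightarrow> operad P \<and> operad Q \<and>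
     (\<forall>A. label_set A \<longrightarrow>
        \<phi> A ` comps P A \<subseteq> comps Q A \<and> linear_from (comps P A) (scale P) (scale Q) (\<phi> A)) \<and>
     (\<forall>A \<sigma>. label_set A \<and> inj_on \<sigma> A \<longrightarrow>
        (\<forall>x\<in>comps P A. \<phi> (\<sigma> ` A) (relabel P A \<sigma> x) = relabel Q A \<sigma> (\<phi> A x))) \<and>
     (\<forall>a. \<phi> {a} (op_unit P a) = op_unit Q a) \<and>
     (\<forall>A B a. label_set A \<and> label_set B \<and> A \<inter> B = {} \<and> a \<in> A \<longrightarrow>
        (\<forall>x\<in>comps P A. \<forall>y\<in>comps P B.
           \<phi> ((A - {a}) \<union> B) (pcomp P A B a x y) = pcomp Q A B a (\<phi> A x) (\<phi> B y)))"


section \<open>Linearization of a set operad\<close>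

text \<open>
  For the set operad with components \<open>X A\<close>, the vector space freely generated by \<open>X A\<close> consists of
  the finitely supported functions on the ambient type that vanish outside of \<open>X A\<close>.
\<close>

definition pm_scale :: "'k::field \<Rightarrow> ('b \<Rightarrow>\<^sub>0 'k) \<Rightarrow> 'b \<Rightarrow>\<^sub>0 'k" where
  "pm_scale c = Poly_Mapping.map ((*) c)"

definition basis_elem :: "'b \<Rightarrow> 'b \<Rightarrow>\<^sub>0 'k::field" where
  "basis_elem b = Poly_Mapping.single b 1"

definition linearization ::
    "(nat set \<Rightarrow> 'b set) \<Rightarrow> (nat set \<Rightarrow> (nat \<Rightarrow> nat) \<Rightarrow> 'b \<Rightarrow> 'b) \<Rightarrow>
     (nat set \<Rightarrow> nat set \<Rightarrow> nat \<Rightarrow> 'b \<Rightarrow> 'b \<Rightarrow> 'b) \<Rightarrow> (nat \<Rightarrow> 'b) \<Rightarrow>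
     ('k::field, 'b \<Rightarrow>\<^sub>0 'k) operad_data" where
  "linearization X rl cmp un =
    \<lparr>comps = (\<lambda>A. {f. Poly_Mapping.keys f \<subseteq> X A}),
     scale = pm_scale,
     relabel = (\<lambda>A \<sigma> f. \<Sum>b \<in> Poly_Mapping.keys f.
       pm_scale (Poly_Mapping.lookup f b) (basis_elem (rl A \<sigma> b))),
     pcomp = (\<lambda>A B a f g. \<Sum>b \<in> Poly_Mapping.keys f. \<Sum>c \<in> Poly_Mapping.keys g.
       pm_scale (Poly_Mapping.lookup f b * Poly_Mapping.lookup g c) (basis_elem (cmp A B a b c))),
     op_unit = (\<lambda>a. basis_elem (un a))\<rparr>"


section \<open>Presentations of operads by binary generators\<close>

text \<open>
  The free operad on a set of binary operations without symmetry: its component over \<open>A\<close> is freely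
  generated by the planar binary trees whose inner nodes carry generators and whose leaves are
  in bijection with \<open>A\<close>, and partial composition grafts a tree onto a leaf.
\<close>

datatype (dead 'g, 'l) btree = Leaf 'l | Node 'g "('g, 'l) btree" "('g, 'l) btree"
  for map: map_leaves

primrec leaves :: "('g, 'l) btree \<Rightarrow> 'l list" where
  "leaves (Leaf a) = [a]"
| "leaves (Node g s t) = leaves s @ leaves t"

primrec graft :: "'l \<Rightarrow> ('g, 'l) btree \<Rightarrow> ('g, 'l) btree \<Rightarrow> ('g, 'l) btree" where
  "graft a (Leaf b) u = (if b = a then u else Leaf b)"
| "graft a (Node g s t) u = Node g (graft a s u) (graft a t u)"

definition free_operad :: "('k::field, ('g, nat) btree \<Rightarrow>\<^sub>0 'k) operad_data" where
  "free_operad = linearization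
     (\<lambda>A. {t. distinct (leaves t) \<and> set (leaves t) = A})
     (\<lambda>A. map_leaves)
     (\<lambda>A B. graft)
     Leaf"

definition free_gen :: "'g \<Rightarrow> ('g, nat) btree \<Rightarrow>\<^sub>0 'k::field" where
  "free_gen g = basis_elem (Node g (Leaf 1) (Leaf 2))"

text \<open>
  \<open>P\<close> is presented by the elements \<open>x g\<close> over \<open>{1, 2}\<close> and the relations \<open>r = 0\<close> for \<open>(A, r) \<in> R\<close>
  if the morphism from the free operad sending \<open>g\<close> to \<open>x g\<close> induces an isomorphism from
  the quotient by the operadic ideal generated by \<open>R\<close> onto \<open>P\<close>.
\<close>

definition presented_by :: "('k::field, 'v::ab_group_add) operad_data \<Rightarrow> ('g \<Rightarrow> 'v) \<Rightarrow>
    (nat set \<times> (('g, nat) btree \<Rightarrow>\<^sub>0 'k)) set \<Rightarrow> bool" where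
  "presented_by P x R \<longleftrightarrow> (\<exists>\<phi>. operad_hom free_operad P \<phi> \<and>
     (\<forall>g. \<phi> {1..2} (free_gen g) = x g) \<and>
     (\<forall>A. label_set A \<longrightarrow>
        \<phi> A ` comps free_operad A = comps P A \<and>
        {f \<in> comps free_operad A. \<phi> A f = 0} = generated_ideal free_operad R A))"


section \<open>The operad of finite posets\<close>

definition poset_pcomp ::
    "nat set \<Rightarrow> nat set \<Rightarrow> nat \<Rightarrow> nat rel \<Rightarrow> nat rel \<Rightarrow> nat rel" where
  "poset_pcomp A B a r s = {(x, y).
     (x \<in> B \<and> y \<in> B \<and> (x, y) \<in> s) \<or>
     (x \<in> A - {a} \<and> y \<in> A - {a} \<and> (x, y) \<in> r) \<or>
     (x \<in> A - {a} \<and> y \<in> B \<and> (x, a) \<in> r) \<or>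
     (x \<in> B \<and> y \<in> A - {a} \<and> (a, y) \<in> r)}"

definition poset_operad :: "('k::field, nat rel \<Rightarrow>\<^sub>0 'k) operad_data" where
  "poset_operad = linearization
     (\<lambda>A. {r. partial_order_on A r})
     (\<lambda>A \<sigma> r. map_prod \<sigma> \<sigma> ` r)
     poset_pcomp
     (\<lambda>a. {(a, a)})"

definition WN :: "nat set \<Rightarrow> nat rel \<Rightarrow> bool" where
  "WN A r \<longleftrightarrow> partial_order_on A r \<and>
     \<not> (\<exists>x y z t. {x, y, z, t} \<subseteq> A \<and> distinct [x, y, z, t] \<and>
          (\<forall>u\<in>{x, y, z, t}. \<forall>v\<in>{x, y, z, t}.
             (u, v) \<in> r \<and> u \<noteq> v \<longleftrightarrow> (u, v) \<in> {(x, z), (y, z), (y, t)}))"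

definition WNP :: "nat set \<Rightarrow> (nat rel \<Rightarrow>\<^sub>0 'k::field) set" where
  "WNP A = module.span pm_scale (basis_elem ` {r. WN A r})"

definition WNP_operad :: "('k::field, nat rel \<Rightarrow>\<^sub>0 'k) operad_data" where
  "WNP_operad = poset_operad\<lparr>comps := WNP\<rparr>"

datatype generator = M | Down

primrec poset_gen :: "generator \<Rightarrow> nat rel \<Rightarrow>\<^sub>0 'k::field" where
  "poset_gen M = basis_elem {(1, 1), (2, 2)}"
| "poset_gen Down = basis_elem {(1, 1), (2, 2), (1, 2)}"

definition WNP_relations :: "(nat set \<times> ((generator, nat) btree \<Rightarrow>\<^sub>0 'k::field)) set" where
  "WNP_relations =
     (let m = free_gen M; d = free_gen Down in
      {({1..2}, relabel free_operad {1..2} (transpose 1 2) m - m),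
       ({1..3}, std_pcomp free_operad 2 2 1 m m - std_pcomp free_operad 2 2 2 m m),
       ({1..3}, std_pcomp free_operad 2 2 1 d d - std_pcomp free_operad 2 2 2 d d)})"

end

theory Submission
  imports Defs
begin

text \<open>
  A tree is sent to the poset that it builds from its leaves by disjoint unions (\<open>M\<close>) and ordinal
  sums (\<open>Down\<close>).  Splitting off a maximal element shows that every WN poset with at least two elements
  is a disjoint union or an ordinal sum of two smaller ones, so the WN posets are exactly the
  posets of trees; in particular they are closed under composition.  The generator at the root of a
  tree is determined by its poset, and two decompositions of one poset have a common refinement
  whose parts are again WN, so by induction two trees with the same poset differ only by
  associativity of both generators and commutativity of \<open>M\<close>.  Everything is done for set operads
  and then linearized: the kernel of the linearized map is spanned by the differences of trees with
  the same poset.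
\<close>

section \<open>Linear extension\<close>

text \<open>Most of the work lies in uniqueness. Two trees of one poset need not cut it at the same
  place, and the parts of a common refinement have to be turned into trees again; hence existence is
  proved for every nonempty subset of the carrier, with the relation kept fixed. For ordinal sums
  the first parts are initial segments, one contained in the other, and associativity suffices. The
  first parts of two disjoint unions may cross; then one tree is flipped if necessary, and both are
  compared with a third one whose first part is the intersection. This is where commutativity
  enters. The passage to ideals has its own obstacle: the relations only concern leaves labelled 1,
  2, 3, and an ideal is closed under partial composition rather than under replacement of subtrees.
  Each rewriting step is therefore obtained by grafting at fresh leaves. For the kernel, one tree is
  chosen for every poset. Subtracting the chosen representatives from an element of the kernel
  changes nothing and exhibits it as a combination of differences of trees with the same
  poset.\<close>

lemma lookup_pm_scale [simp]:
  "Poly_Mapping.lookup (pm_scale c f) x = c * Poly_Mapping.lookup f x"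
  by (simp add: pm_scale_def Poly_Mapping.map.rep_eq when_def)

lemma vector_space_pm_scale: "vector_space pm_scale"
  by unfold_locales (simp_all add: poly_mapping_eq_iff fun_eq_iff lookup_add algebra_simps)

global_interpretation pm: vector_space pm_scale
  by (rule vector_space_pm_scale)

lemma keys_pm_scale_subset: "Poly_Mapping.keys (pm_scale c f) \<subseteq> Poly_Mapping.keys f"
  by (auto simp: in_keys_iff)

lemma keys_basis_elem [simp]: "Poly_Mapping.keys (basis_elem b :: _ \<Rightarrow>\<^sub>0 'k::field) = {b}"
  by (simp add: basis_elem_def)

lemma lookup_basis_elem:
  "Poly_Mapping.lookup (basis_elem b) x = (if b = x then 1 else 0)"
  by (simp add: basis_elem_def lookup_single when_def)

lemma subspace_supported_on: "pm.subspace {f. Poly_Mapping.keys f \<subseteq> X}"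
  by (rule pm.subspaceI)
    (simp_all add: order_trans[OF Poly_Mapping.keys_add] order_trans[OF keys_pm_scale_subset])

lemma basis_expansion:
  assumes "finite S" "Poly_Mapping.keys f \<subseteq> S"
  shows "f = (\<Sum>b\<in>S. pm_scale (Poly_Mapping.lookup f b) (basis_elem b))"
proof (rule poly_mapping_eqI)
  fix x
  have "Poly_Mapping.lookup (\<Sum>b\<in>S. pm_scale (Poly_Mapping.lookup f b) (basis_elem b)) x =
      (\<Sum>b\<in>S. if x = b then Poly_Mapping.lookup f b else 0)"
    by (auto simp: lookup_sum lookup_basis_elem intro!: sum.cong)
  also have "\<dots> = Poly_Mapping.lookup f x"
    using assms by (auto simp: in_keys_iff)
  finally show "Poly_Mapping.lookup f x =
      Poly_Mapping.lookup (\<Sum>b\<in>S. pm_scale (Poly_Mapping.lookup f b) (basis_elem b)) x" ..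
qed

text \<open>Reconciles the two descriptions in use: components of a linearization are defined by
  supports, \<open>WNP\<close> by a span. It also makes span induction available for
  supports.\<close>

lemma supported_on_eq_span:
  "{f :: 'b \<Rightarrow>\<^sub>0 'k::field. Poly_Mapping.keys f \<subseteq> X} = pm.span (basis_elem ` X)"
proof
  show "{f :: 'b \<Rightarrow>\<^sub>0 'k. Poly_Mapping.keys f \<subseteq> X} \<subseteq> pm.span (basis_elem ` X)"
  proof
    fix f :: "'b \<Rightarrow>\<^sub>0 'k"
    assume "f \<in> {f. Poly_Mapping.keys f \<subseteq> X}"
    then have "(\<Sum>b\<in>Poly_Mapping.keys f. pm_scale (Poly_Mapping.lookup f b) (basis_elem b))
        \<in> pm.span (basis_elem ` X)"
      by (intro pm.span_sum pm.span_scale pm.span_base) auto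
    then show "f \<in> pm.span (basis_elem ` X)"
      by (simp flip: basis_expansion)
  qed
  show "pm.span (basis_elem ` X) \<subseteq> {f :: 'b \<Rightarrow>\<^sub>0 'k. Poly_Mapping.keys f \<subseteq> X}"
    by (rule pm.span_minimal) (auto simp: subspace_supported_on)
qed

text \<open>The workhorse for identities between linear maps: for such an identity only the
  \<open>basis\<close> case has content, the other three are closed by linearity.\<close>

lemma supported_on_induct [consumes 1, case_names zero basis add scale]:
  assumes "Poly_Mapping.keys f \<subseteq> X"
    and "P 0"
    and "\<And>b. b \<in> X \<Longrightarrow> P (basis_elem b)"
    and "\<And>f g. P f \<Longrightarrow> P g \<Longrightarrow> P (f + g)"
    and "\<And>c f. P f \<Longrightarrow> P (pm_scale c f)"
  shows "P f"
proof -
  have "f \<in> pm.span (basis_elem ` X)"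
    using assms(1) supported_on_eq_span by blast
  then show ?thesis
    by (induction f rule: pm.span_induct_alt) (auto intro: assms(2-))
qed

definition lin_ext :: "('b \<Rightarrow> ('c \<Rightarrow>\<^sub>0 'k)) \<Rightarrow> ('b \<Rightarrow>\<^sub>0 'k::field) \<Rightarrow> 'c \<Rightarrow>\<^sub>0 'k" where
  "lin_ext h f = (\<Sum>b\<in>Poly_Mapping.keys f. pm_scale (Poly_Mapping.lookup f b) (h b))"

text \<open>Additivity compares sums over the supports of \<open>f\<close>, \<open>g\<close> and
  \<open>f + g\<close>, which may all differ; a common finite index set is harmless because the
  extra coefficients vanish.\<close>

lemma lin_ext_superset:
  assumes "finite S" "Poly_Mapping.keys f \<subseteq> S"
  shows "lin_ext h f = (\<Sum>b\<in>S. pm_scale (Poly_Mapping.lookup f b) (h b))"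
  unfolding lin_ext_def by (rule sum.mono_neutral_left) (use assms in \<open>auto simp: in_keys_iff\<close>)

lemma lin_ext_zero [simp]: "lin_ext h 0 = 0"
  by (simp add: lin_ext_def)

lemma lin_ext_add [simp]: "lin_ext h (f + g) = lin_ext h f + lin_ext h g"
proof -
  let ?S = "Poly_Mapping.keys f \<union> Poly_Mapping.keys g"
  have "lin_ext h u = (\<Sum>b\<in>?S. pm_scale (Poly_Mapping.lookup u b) (h b))"
    if "u \<in> {f, g, f + g}" for u
    using that Poly_Mapping.keys_add[of f g] by (intro lin_ext_superset) auto
  then show ?thesis
    by (simp add: lookup_add pm.scale_left_distrib sum.distrib)
qed

lemma lin_ext_scale [simp]: "lin_ext h (pm_scale c f) = pm_scale c (lin_ext h f)"
  by (subst lin_ext_superset[OF finite_keys keys_pm_scale_subset])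
    (simp add: lin_ext_def pm.scale_sum_right)

lemma lin_ext_basis [simp]: "lin_ext h (basis_elem b) = h b"
  unfolding lin_ext_def by (simp add: lookup_basis_elem)

lemma lin_ext_minus [simp]: "lin_ext h (f - g) = lin_ext h f - lin_ext h g"
  using lin_ext_add[of h "f - g" g] by (simp add: algebra_simps)

lemma lin_ext_zero_fun [simp]: "lin_ext (\<lambda>b. 0) f = 0"
  by (simp add: lin_ext_def)

lemma lin_ext_add_fun [simp]: "lin_ext (\<lambda>b. h b + h' b) f = lin_ext h f + lin_ext h' f"
  by (simp add: lin_ext_def pm.scale_right_distrib sum.distrib)

lemma lin_ext_scale_fun [simp]: "lin_ext (\<lambda>b. pm_scale c (h b)) f = pm_scale c (lin_ext h f)"
  by (simp add: lin_ext_def pm.scale_sum_right mult.commute)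

lemma lin_ext_cong:
  assumes "Poly_Mapping.keys f \<subseteq> X" "\<And>b. b \<in> X \<Longrightarrow> h b = h' b"
  shows "lin_ext h f = lin_ext h' f"
  unfolding lin_ext_def using assms by (auto intro!: sum.cong)

lemma lin_ext_subspace:
  assumes "pm.subspace V" "Poly_Mapping.keys f \<subseteq> X" "\<And>b. b \<in> X \<Longrightarrow> h b \<in> V"
  shows "lin_ext h f \<in> V"
  unfolding lin_ext_def using assms by (auto intro!: pm.subspace_sum pm.subspace_scale)

lemma keys_lin_ext_basis:
  assumes "Poly_Mapping.keys f \<subseteq> X" "\<And>b. b \<in> X \<Longrightarrow> g b \<in> Y"
  shows "Poly_Mapping.keys (lin_ext (\<lambda>b. basis_elem (g b)) f) \<subseteq> Y"
  using lin_ext_subspace[OF subspace_supported_on[of Y] assms(1), of "\<lambda>b. basis_elem (g b)"]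
    assms(2) by simp

section \<open>Bilinear extension and the operations of a linearization\<close>

definition bilin_ext ::
    "('b \<Rightarrow> 'c \<Rightarrow> 'd) \<Rightarrow> ('b \<Rightarrow>\<^sub>0 'k::field) \<Rightarrow> ('c \<Rightarrow>\<^sub>0 'k) \<Rightarrow> 'd \<Rightarrow>\<^sub>0 'k" where
  "bilin_ext h f g = lin_ext (\<lambda>b. lin_ext (\<lambda>c. basis_elem (h b c)) g) f"

lemma bilin_ext_simps [simp]:
  "bilin_ext h 0 g = 0" "bilin_ext h f 0 = 0"
  "bilin_ext h (f + f') g = bilin_ext h f g + bilin_ext h f' g"
  "bilin_ext h f (g + g') = bilin_ext h f g + bilin_ext h f g'"
  "bilin_ext h (pm_scale a f) g = pm_scale a (bilin_ext h f g)"
  "bilin_ext h f (pm_scale a g) = pm_scale a (bilin_ext h f g)"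
  "bilin_ext h (basis_elem b) (basis_elem c) = basis_elem (h b c)"
  by (simp_all add: bilin_ext_def)

lemma bilin_ext_minus [simp]:
  "bilin_ext h (f - f') g = bilin_ext h f g - bilin_ext h f' g"
  "bilin_ext h f (g - g') = bilin_ext h f g - bilin_ext h f g'"
  using bilin_ext_simps(3)[of h "f - f'" f' g] bilin_ext_simps(4)[of h f "g - g'" g']
  by (simp_all add: algebra_simps)

lemma keys_bilin_ext:
  assumes "Poly_Mapping.keys f \<subseteq> X" "Poly_Mapping.keys g \<subseteq> Y"
    "\<And>b c. b \<in> X \<Longrightarrow> c \<in> Y \<Longrightarrow> h b c \<in> Z"
  shows "Poly_Mapping.keys (bilin_ext h f g) \<subseteq> Z"
proof -
  have "lin_ext (\<lambda>c. basis_elem (h b c)) g \<in> {u. Poly_Mapping.keys u \<subseteq> Z}" if "b \<in> X" for b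
    using keys_lin_ext_basis[OF assms(2), of "h b" Z] assms(3)[OF that] by simp
  then show ?thesis
    using lin_ext_subspace[OF subspace_supported_on[of Z] assms(1)] by (simp add: bilin_ext_def)
qed

text \<open>Replaces the explicit sums in the record by \<open>lin_ext\<close> and
  \<open>bilin_ext\<close>, whose simplification rules carry all later computations.\<close>

lemma linearization_sel [simp]:
  "comps (linearization X rl cmp un) A = {f. Poly_Mapping.keys f \<subseteq> X A}"
  "scale (linearization X rl cmp un) = pm_scale"
  "relabel (linearization X rl cmp un) A \<sigma> = lin_ext (\<lambda>b. basis_elem (rl A \<sigma> b))"
  "pcomp (linearization X rl cmp un) A B a = bilin_ext (cmp A B a)"
  "op_unit (linearization X rl cmp un) a = basis_elem (un a)"
  by (simp_all add: linearization_def lin_ext_def bilin_ext_def fun_eq_iff pm.scale_sum_right)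


section \<open>Set operads and their linearizations\<close>

text \<open>The axioms of \<open>operad\<close> with the linear structure removed, in the same
  shape, so that each of them is the basis case of its linear counterpart.\<close>

locale set_operad =
  fixes X :: "nat set \<Rightarrow> 'b set"
    and rl :: "nat set \<Rightarrow> (nat \<Rightarrow> nat) \<Rightarrow> 'b \<Rightarrow> 'b"
    and cmp :: "nat set \<Rightarrow> nat set \<Rightarrow> nat \<Rightarrow> 'b \<Rightarrow> 'b \<Rightarrow> 'b"
    and un :: "nat \<Rightarrow> 'b"
  assumes rl_closed: "label_set A \<Longrightarrow> inj_on \<sigma> A \<Longrightarrow> x \<in> X A \<Longrightarrow> rl A \<sigma> x \<in> X (\<sigma> ` A)"
    and rl_cong: "label_set A \<Longrightarrow> inj_on \<sigma> A \<Longrightarrow> x \<in> X A \<Longrightarrow>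
      (\<And>a. a \<in> A \<Longrightarrow> \<sigma> a = \<tau> a) \<Longrightarrow> rl A \<sigma> x = rl A \<tau> x"
    and rl_id: "label_set A \<Longrightarrow> x \<in> X A \<Longrightarrow> rl A id x = x"
    and rl_comp: "label_set A \<Longrightarrow> inj_on \<sigma> A \<Longrightarrow> inj_on \<tau> (\<sigma> ` A) \<Longrightarrow> x \<in> X A \<Longrightarrow>
      rl A (\<tau> \<circ> \<sigma>) x = rl (\<sigma> ` A) \<tau> (rl A \<sigma> x)"
    and un_closed: "un a \<in> X {a}"
    and rl_un: "rl {a} \<sigma> (un a) = un (\<sigma> a)"
    and cmp_closed: "label_set A \<Longrightarrow> label_set B \<Longrightarrow> A \<inter> B = {} \<Longrightarrow> a \<in> A \<Longrightarrow>
      x \<in> X A \<Longrightarrow> y \<in> X B \<Longrightarrow> cmp A B a x y \<in> X ((A - {a}) \<union> B)"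
    and rl_cmp: "label_set A \<Longrightarrow> label_set B \<Longrightarrow> A \<inter> B = {} \<Longrightarrow> a \<in> A \<Longrightarrow>
      inj_on \<sigma> (A \<union> B) \<Longrightarrow> x \<in> X A \<Longrightarrow> y \<in> X B \<Longrightarrow>
      rl ((A - {a}) \<union> B) \<sigma> (cmp A B a x y) = cmp (\<sigma> ` A) (\<sigma> ` B) (\<sigma> a) (rl A \<sigma> x) (rl B \<sigma> y)"
    and cmp_unit_left: "label_set B \<Longrightarrow> b \<notin> B \<Longrightarrow> y \<in> X B \<Longrightarrow> cmp {b} B b (un b) y = y"
    and cmp_unit_right: "label_set A \<Longrightarrow> a \<in> A \<Longrightarrow> b \<notin> A \<Longrightarrow> x \<in> X A \<Longrightarrow>
      cmp A {b} a x (un b) = rl A (id(a := b)) x"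
    and cmp_sequential: "label_set A \<Longrightarrow> label_set B \<Longrightarrow> label_set C \<Longrightarrow>
      A \<inter> B = {} \<Longrightarrow> A \<inter> C = {} \<Longrightarrow> B \<inter> C = {} \<Longrightarrow> a \<in> A \<Longrightarrow> b \<in> B \<Longrightarrow>
      x \<in> X A \<Longrightarrow> y \<in> X B \<Longrightarrow> z \<in> X C \<Longrightarrow>
      cmp ((A - {a}) \<union> B) C b (cmp A B a x y) z = cmp A ((B - {b}) \<union> C) a x (cmp B C b y z)"
    and cmp_parallel: "label_set A \<Longrightarrow> label_set B \<Longrightarrow> label_set C \<Longrightarrow>
      A \<inter> B = {} \<Longrightarrow> A \<inter> C = {} \<Longrightarrow> B \<inter> C = {} \<Longrightarrow> a \<in> A \<Longrightarrow> a' \<in> A \<Longrightarrow> a \<noteq> a' \<Longrightarrow>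
      x \<in> X A \<Longrightarrow> y \<in> X B \<Longrightarrow> z \<in> X C \<Longrightarrow>
      cmp ((A - {a}) \<union> B) C a' (cmp A B a x y) z = cmp ((A - {a'}) \<union> C) B a (cmp A C a' x z) y"

text \<open>The equations are inherited from the larger family, so only the closure properties have
  to be supplied for the smaller one.\<close>

lemma set_operad_subset:
  assumes "set_operad X rl cmp un"
    and "\<And>A. label_set A \<Longrightarrow> Y A \<subseteq> X A"
    and "\<And>A \<sigma> x. label_set A \<Longrightarrow> inj_on \<sigma> A \<Longrightarrow> x \<in> Y A \<Longrightarrow> rl A \<sigma> x \<in> Y (\<sigma> ` A)"
    and "\<And>a. un a \<in> Y {a}"
    and "\<And>A B a x y. label_set A \<Longrightarrow> label_set B \<Longrightarrow> A \<inter> B = {} \<Longrightarrow> a \<in> A \<Longrightarrow>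
      x \<in> Y A \<Longrightarrow> y \<in> Y B \<Longrightarrow> cmp A B a x y \<in> Y ((A - {a}) \<union> B)"
  shows "set_operad Y rl cmp un"
proof -
  interpret set_operad X rl cmp un by fact
  have sub: "x \<in> X A" if "label_set A" "x \<in> Y A" for x A
    using assms(2) that by blast
  show ?thesis
  proof
    fix A x and \<sigma> \<tau> :: "nat \<Rightarrow> nat"
    assume A: "label_set A" "inj_on \<sigma> A" "x \<in> Y A"
    show "rl A \<sigma> x \<in> Y (\<sigma> ` A)"
      using A by (rule assms(3))
    show "rl A \<sigma> x = rl A \<tau> x" if "\<And>a. a \<in> A \<Longrightarrow> \<sigma> a = \<tau> a"
      using A sub that by (intro rl_cong) auto
    show "rl A (\<tau> \<circ> \<sigma>) x = rl (\<sigma> ` A) \<tau> (rl A \<sigma> x)" if "inj_on \<tau> (\<sigma> ` A)"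
      using A sub that by (intro rl_comp) auto
  next
    show "cmp (A - {a} \<union> B) C a' (cmp A B a x y) z = cmp (A - {a'} \<union> C) B a (cmp A C a' x z) y"
      if "label_set A" "label_set B" "label_set C" "A \<inter> B = {}" "A \<inter> C = {}" "B \<inter> C = {}"
        "a \<in> A" "a' \<in> A" "a \<noteq> a'" "x \<in> Y A" "y \<in> Y B" "z \<in> Y C" for A B C a a' x y z
      using that by (intro cmp_parallel sub)
  qed (simp_all add: sub assms(4,5) rl_id rl_un rl_cmp cmp_unit_left cmp_unit_right
      cmp_sequential)
qed

context set_operad
begin

text \<open>Both sides of each equational axiom are linear in every argument. One support induction
  per argument, nested inside each other, reduces the axiom to basis elements, where it is the axiom
  of the set operad.\<close>

theorem operad_linearization:
  "operad (linearization X rl cmp un :: ('k::field, 'b \<Rightarrow>\<^sub>0 'k) operad_data)"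
proof (rule operad.intro)
  show "vector_space (scale (linearization X rl cmp un :: ('k, 'b \<Rightarrow>\<^sub>0 'k) operad_data))"
    by (simp add: vector_space_pm_scale)
next
  fix A
  show "module.subspace (scale (linearization X rl cmp un))
      (comps (linearization X rl cmp un :: ('k, 'b \<Rightarrow>\<^sub>0 'k) operad_data) A)"
    by (simp add: subspace_supported_on)
next
  fix A and \<sigma> :: "nat \<Rightarrow> nat" and x :: "'b \<Rightarrow>\<^sub>0 'k"
  assume A: "label_set A" "inj_on \<sigma> A"
  show "linear_from (comps (linearization X rl cmp un) A) (scale (linearization X rl cmp un))
      (scale (linearization X rl cmp un))
      (relabel (linearization X rl cmp un :: ('k, 'b \<Rightarrow>\<^sub>0 'k) operad_data) A \<sigma>)"
    by (simp add: linear_from_def)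
  assume x: "x \<in> comps (linearization X rl cmp un) A"
  show "relabel (linearization X rl cmp un) A \<sigma> x \<in> comps (linearization X rl cmp un) (\<sigma> ` A)"
    using x by (simp add: keys_lin_ext_basis rl_closed[OF A])
  show "relabel (linearization X rl cmp un) A \<sigma> x = relabel (linearization X rl cmp un) A \<tau> x"
    if "\<And>a. a \<in> A \<Longrightarrow> \<sigma> a = \<tau> a" for \<tau> :: "nat \<Rightarrow> nat"
    using x rl_cong[OF A _ that] by (auto intro!: lin_ext_cong)
  show "relabel (linearization X rl cmp un) A (\<tau> \<circ> \<sigma>) x =
      relabel (linearization X rl cmp un) (\<sigma> ` A) \<tau> (relabel (linearization X rl cmp un) A \<sigma> x)"
    if "inj_on \<tau> (\<sigma> ` A)" for \<tau>
    using x by simp (induction rule: supported_on_induct; simp add: rl_comp[unfolded comp_def] A that)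
next
  fix A and x :: "'b \<Rightarrow>\<^sub>0 'k"
  assume A: "label_set A" and x: "x \<in> comps (linearization X rl cmp un) A"
  show "relabel (linearization X rl cmp un) A id x = x"
    using x by simp (induction rule: supported_on_induct; simp add: rl_id[unfolded id_def] A)
  show "pcomp (linearization X rl cmp un) A {b} a x (op_unit (linearization X rl cmp un) b) =
      relabel (linearization X rl cmp un) A (id(a := b)) x" if "a \<in> A" "b \<notin> A" for a b
    using x by simp (induction rule: supported_on_induct; simp add: cmp_unit_right[unfolded fun_upd_def id_apply] A that)
  show "pcomp (linearization X rl cmp un) {b} A b (op_unit (linearization X rl cmp un) b) x = x"
    if "b \<notin> A" for b
    using x by simp (induction rule: supported_on_induct; simp add: cmp_unit_left A that)
next
  fix a and \<sigma> :: "nat \<Rightarrow> nat"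
  show "op_unit (linearization X rl cmp un :: ('k, 'b \<Rightarrow>\<^sub>0 'k) operad_data) a
      \<in> comps (linearization X rl cmp un) {a}"
    by (simp add: un_closed)
  show "relabel (linearization X rl cmp un) {a} \<sigma> (op_unit (linearization X rl cmp un) a) =
      (op_unit (linearization X rl cmp un) (\<sigma> a) :: 'b \<Rightarrow>\<^sub>0 'k)"
    by (simp add: rl_un)
next
  fix A B a and x y :: "'b \<Rightarrow>\<^sub>0 'k"
  assume AB: "label_set A" "label_set B" "A \<inter> B = {}" "a \<in> A"
  show "linear_from (comps (linearization X rl cmp un) A) (scale (linearization X rl cmp un))
      (scale (linearization X rl cmp un)) (\<lambda>x. pcomp (linearization X rl cmp un) A B a x y)"
    by (simp add: linear_from_def)
  show "linear_from (comps (linearization X rl cmp un) B) (scale (linearization X rl cmp un))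
      (scale (linearization X rl cmp un)) (pcomp (linearization X rl cmp un) A B a x)"
    by (simp add: linear_from_def)
  assume x: "x \<in> comps (linearization X rl cmp un) A"
    and y: "y \<in> comps (linearization X rl cmp un) B"
  show "pcomp (linearization X rl cmp un) A B a x y
      \<in> comps (linearization X rl cmp un) (A - {a} \<union> B)"
    using keys_bilin_ext[OF _ _ cmp_closed[OF AB]] x y by simp
  show "relabel (linearization X rl cmp un) (A - {a} \<union> B) \<sigma>
        (pcomp (linearization X rl cmp un) A B a x y) =
      pcomp (linearization X rl cmp un) (\<sigma> ` A) (\<sigma> ` B) (\<sigma> a)
        (relabel (linearization X rl cmp un) A \<sigma> x) (relabel (linearization X rl cmp un) B \<sigma> y)"
    if "inj_on \<sigma> (A \<union> B)" for \<sigma>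
    using x y
  proof simp
    assume "Poly_Mapping.keys x \<subseteq> X A" "Poly_Mapping.keys y \<subseteq> X B"
    then show "lin_ext (\<lambda>b. basis_elem (rl (A - {a} \<union> B) \<sigma> b)) (bilin_ext (cmp A B a) x y) =
      bilin_ext (cmp (\<sigma> ` A) (\<sigma> ` B) (\<sigma> a)) (lin_ext (\<lambda>b. basis_elem (rl A \<sigma> b)) x)
        (lin_ext (\<lambda>b. basis_elem (rl B \<sigma> b)) y)"
    \<comment> \<open>The premise on \<open>y\<close> takes part in the induction on
      \<open>x\<close>, so that it is at hand in the basis case for the inner induction.\<close>
    proof (induction arbitrary: y rule: supported_on_induct)
      case (basis b)
      from basis(2) show ?case
        by (induction rule: supported_on_induct) (simp_all add: rl_cmp AB that basis)
    qed simp_all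
  qed
next
  fix A B C a b and x y z :: "'b \<Rightarrow>\<^sub>0 'k"
  assume ABC: "label_set A" "label_set B" "label_set C"
      "A \<inter> B = {}" "A \<inter> C = {}" "B \<inter> C = {}" "a \<in> A" "b \<in> B"
    and "x \<in> comps (linearization X rl cmp un) A"
      "y \<in> comps (linearization X rl cmp un) B"
      "z \<in> comps (linearization X rl cmp un) C"
  then have "Poly_Mapping.keys x \<subseteq> X A" "Poly_Mapping.keys y \<subseteq> X B" "Poly_Mapping.keys z \<subseteq> X C"
    by simp_all
  then have "bilin_ext (cmp (A - {a} \<union> B) C b) (bilin_ext (cmp A B a) x y) z =
      bilin_ext (cmp A (B - {b} \<union> C) a) x (bilin_ext (cmp B C b) y z)"
  proof (induction arbitrary: y z rule: supported_on_induct)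
    case (basis p)
    from basis(2,3) show ?case
    proof (induction arbitrary: z rule: supported_on_induct)
      case (basis q)
      from basis(2) show ?case
        by (induction rule: supported_on_induct)
          (simp_all add: cmp_sequential ABC basis \<open>p \<in> X A\<close>)
    qed simp_all
  qed simp_all
  then show "pcomp (linearization X rl cmp un) (A - {a} \<union> B) C b
        (pcomp (linearization X rl cmp un) A B a x y) z =
      pcomp (linearization X rl cmp un) A (B - {b} \<union> C) a x
        (pcomp (linearization X rl cmp un) B C b y z)"
    by simp
next
  fix A B C a a' and x y z :: "'b \<Rightarrow>\<^sub>0 'k"
  assume ABC: "label_set A" "label_set B" "label_set C"
      "A \<inter> B = {}" "A \<inter> C = {}" "B \<inter> C = {}" "a \<in> A" "a' \<in> A" "a \<noteq> a'"
    and "x \<in> comps (linearization X rl cmp un) A"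
      "y \<in> comps (linearization X rl cmp un) B"
      "z \<in> comps (linearization X rl cmp un) C"
  then have "Poly_Mapping.keys x \<subseteq> X A" "Poly_Mapping.keys y \<subseteq> X B" "Poly_Mapping.keys z \<subseteq> X C"
    by simp_all
  then have "bilin_ext (cmp (A - {a} \<union> B) C a') (bilin_ext (cmp A B a) x y) z =
      bilin_ext (cmp (A - {a'} \<union> C) B a) (bilin_ext (cmp A C a') x z) y"
  proof (induction arbitrary: y z rule: supported_on_induct)
    case (basis p)
    from basis(2,3) show ?case
    proof (induction arbitrary: z rule: supported_on_induct)
      case (basis q)
      from basis(2) show ?case
        by (induction rule: supported_on_induct)
          (simp_all add: cmp_parallel[OF ABC] basis \<open>p \<in> X A\<close>)
    qed simp_all
  qed simp_all
  then show "pcomp (linearization X rl cmp un) (A - {a} \<union> B) C a'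
        (pcomp (linearization X rl cmp un) A B a x y) z =
      pcomp (linearization X rl cmp un) (A - {a'} \<union> C) B a
        (pcomp (linearization X rl cmp un) A C a' x z) y"
    by simp
qed

end

section \<open>Morphisms of linearized operads and kernels of morphisms\<close>

lemma operad_hom_lin_ext:
  fixes \<pi> :: "'b \<Rightarrow> 'c"
  assumes "set_operad X rl cmp un" "set_operad Y rl' cmp' un'"
    and closed: "\<And>A x. label_set A \<Longrightarrow> x \<in> X A \<Longrightarrow> \<pi> x \<in> Y A"
    and rl: "\<And>A \<sigma> x. label_set A \<Longrightarrow> inj_on \<sigma> A \<Longrightarrow> x \<in> X A \<Longrightarrow> \<pi> (rl A \<sigma> x) = rl' A \<sigma> (\<pi> x)"
    and un: "\<And>a. \<pi> (un a) = un' a"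
    and cmp: "\<And>A B a x y. label_set A \<Longrightarrow> label_set B \<Longrightarrow> A \<inter> B = {} \<Longrightarrow> a \<in> A \<Longrightarrow>
      x \<in> X A \<Longrightarrow> y \<in> X B \<Longrightarrow> \<pi> (cmp A B a x y) = cmp' A B a (\<pi> x) (\<pi> y)"
  shows "operad_hom (linearization X rl cmp un) (linearization Y rl' cmp' un')
    (\<lambda>A. lin_ext (\<lambda>x. basis_elem (\<pi> x) :: 'c \<Rightarrow>\<^sub>0 'k::field))"
  unfolding operad_hom_def
proof (intro conjI allI impI ballI)
  fix A
  assume A: "label_set A"
  show "lin_ext (\<lambda>x. basis_elem (\<pi> x)) ` comps (linearization X rl cmp un) A
      \<subseteq> comps (linearization Y rl' cmp' un' :: ('k, 'c \<Rightarrow>\<^sub>0 'k) operad_data) A"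
    using closed[OF A] keys_lin_ext_basis[of _ "X A" \<pi> "Y A"] by auto
  show "linear_from (comps (linearization X rl cmp un) A) (scale (linearization X rl cmp un))
      (scale (linearization Y rl' cmp' un')) (lin_ext (\<lambda>x. basis_elem (\<pi> x) :: 'c \<Rightarrow>\<^sub>0 'k))"
    by (simp add: linear_from_def)
next
  fix A and \<sigma> :: "nat \<Rightarrow> nat" and x :: "'b \<Rightarrow>\<^sub>0 'k"
  assume A: "label_set A \<and> inj_on \<sigma> A" and "x \<in> comps (linearization X rl cmp un) A"
  then have "Poly_Mapping.keys x \<subseteq> X A"
    by simp
  then show "lin_ext (\<lambda>x. basis_elem (\<pi> x)) (relabel (linearization X rl cmp un) A \<sigma> x) =
      relabel (linearization Y rl' cmp' un') A \<sigma> (lin_ext (\<lambda>x. basis_elem (\<pi> x)) x)"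
    by (induction rule: supported_on_induct) (use A in \<open>simp_all add: rl\<close>)
next
  fix A B a and x y :: "'b \<Rightarrow>\<^sub>0 'k"
  assume AB: "label_set A \<and> label_set B \<and> A \<inter> B = {} \<and> a \<in> A"
    and "x \<in> comps (linearization X rl cmp un) A" "y \<in> comps (linearization X rl cmp un) B"
  then have "Poly_Mapping.keys x \<subseteq> X A" "Poly_Mapping.keys y \<subseteq> X B"
    by simp_all
  then show "lin_ext (\<lambda>x. basis_elem (\<pi> x)) (pcomp (linearization X rl cmp un) A B a x y) =
      pcomp (linearization Y rl' cmp' un') A B a (lin_ext (\<lambda>x. basis_elem (\<pi> x)) x)
        (lin_ext (\<lambda>x. basis_elem (\<pi> x)) y)"
  proof (induction arbitrary: y rule: supported_on_induct)
    case (basis p)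
    from basis(2) show ?case
      by (induction rule: supported_on_induct) (use AB basis in \<open>simp_all add: cmp\<close>)
  qed simp_all
qed (use assms in \<open>simp_all add: set_operad.operad_linearization un\<close>)

text \<open>A composite with one factor in the kernel is sent to a composite with a zero factor, and
  this is zero because composition is linear in each argument. That linear maps send zero to zero
  comes from additivity, as f(0 + 0) = f(0) + f(0).\<close>

lemma operad_ideal_kernel:
  assumes "operad_hom P Q \<phi>"
  shows "operad_ideal P (\<lambda>A. {f \<in> comps P A. \<phi> A f = 0})"
proof -
  have P: "operad P" and Q: "operad Q"
    and closed: "\<And>A x. label_set A \<Longrightarrow> x \<in> comps P A \<Longrightarrow> \<phi> A x \<in> comps Q A"
    and lin: "\<And>A. label_set A \<Longrightarrow> linear_from (comps P A) (scale P) (scale Q) (\<phi> A)"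
    and rl: "\<And>A \<sigma> x. label_set A \<Longrightarrow> inj_on \<sigma> A \<Longrightarrow> x \<in> comps P A \<Longrightarrow>
      \<phi> (\<sigma> ` A) (relabel P A \<sigma> x) = relabel Q A \<sigma> (\<phi> A x)"
    and cmp: "\<And>A B a x y. label_set A \<Longrightarrow> label_set B \<Longrightarrow> A \<inter> B = {} \<Longrightarrow> a \<in> A \<Longrightarrow>
      x \<in> comps P A \<Longrightarrow> y \<in> comps P B \<Longrightarrow>
      \<phi> ((A - {a}) \<union> B) (pcomp P A B a x y) = pcomp Q A B a (\<phi> A x) (\<phi> B y)"
    using assms by (simp_all add: operad_hom_def image_subset_iff)
  interpret P: operad P by fact
  interpret Q: operad Q by fact
  interpret VP: Vector_Spaces.vector_space "scale P" by (rule P.vector_space)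
  interpret VQ: Vector_Spaces.vector_space "scale Q" by (rule Q.vector_space)
  have zero: "f 0 = 0" if "linear_from V (scale R) (scale Q) f" "0 \<in> V" for V R f
    using that unfolding linear_from_def by (metis add_cancel_left_right add_0)
  have Q0: "0 \<in> comps Q A" if "label_set A" for A
    using Q.subspace[OF that] VQ.subspace_0 by blast
  show ?thesis
    unfolding operad_ideal_def
  proof (intro conjI allI impI ballI subsetI)
    fix A
    assume A: "label_set A"
    note sub = P.subspace[OF A]
    have "\<phi> A 0 = 0"
      using zero[OF lin[OF A]] VP.subspace_0[OF sub] .
    then show "VP.subspace {f \<in> comps P A. \<phi> A f = 0}"
      using lin[OF A] sub unfolding linear_from_def VP.subspace_def by auto
  qed (auto simp: rl cmp P.relabel_closed P.pcomp_closed closed Q0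
      zero[OF Q.relabel_linear] zero[OF Q.pcomp_linear_left] zero[OF Q.pcomp_linear_right])
qed


section \<open>The set operad of posets\<close>

lemma partial_order_on_alt:
  "partial_order_on A r \<longleftrightarrow> r \<subseteq> A \<times> A \<and> (\<forall>x\<in>A. (x, x) \<in> r) \<and>
    (\<forall>x y z. (x, y) \<in> r \<longrightarrow> (y, z) \<in> r \<longrightarrow> (x, z) \<in> r) \<and>
    (\<forall>x y. (x, y) \<in> r \<longrightarrow> (y, x) \<in> r \<longrightarrow> x = y)"
  by (auto simp: partial_order_on_def preorder_on_def refl_on_def trans_def antisym_def)

lemma map_prod_image_in_iff:
  assumes "r \<subseteq> A \<times> A" "inj_on \<sigma> A" "x \<in> A" "y \<in> A"
  shows "(\<sigma> x, \<sigma> y) \<in> map_prod \<sigma> \<sigma> ` r \<longleftrightarrow> (x, y) \<in> r"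
  using inj_on_image_mem_iff[OF map_prod_inj_on[OF assms(2,2)], of "(x, y)" r] assms by simp

text \<open>Pulls an equality of relations on the image back to the source, where the two relations
  can be compared pointwise without witnesses for the image.\<close>

lemma rel_image_eqI:
  assumes "inj_on \<sigma> A" "r \<subseteq> A \<times> A" "s \<subseteq> \<sigma> ` A \<times> \<sigma> ` A"
    and "\<And>x y. x \<in> A \<Longrightarrow> y \<in> A \<Longrightarrow> (\<sigma> x, \<sigma> y) \<in> s \<longleftrightarrow> (x, y) \<in> r"
  shows "map_prod \<sigma> \<sigma> ` r = s"
  using assms by fast

lemma map_prod_image_cong:
  assumes "r \<subseteq> A \<times> A" "\<And>a. a \<in> A \<Longrightarrow> \<sigma> a = \<tau> a"
  shows "map_prod \<sigma> \<sigma> ` r = map_prod \<tau> \<tau> ` r"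
  by (rule image_cong) (use assms in auto)

lemma partial_order_on_image:
  assumes "partial_order_on A r" "inj_on \<sigma> A"
  shows "partial_order_on (\<sigma> ` A) (map_prod \<sigma> \<sigma> ` r)"
proof -
  let ?s = "map_prod \<sigma> \<sigma> ` r"
  have r: "r \<subseteq> A \<times> A"
    using assms(1) by (simp add: partial_order_on_alt)
  have s: "?s \<subseteq> \<sigma> ` A \<times> \<sigma> ` A"
    using r by auto
  note iff = map_prod_image_in_iff[OF r assms(2)]
  show ?thesis
    unfolding partial_order_on_alt
  proof (intro conjI allI impI ballI s)
    fix x
    assume "x \<in> \<sigma> ` A"
    then show "(x, x) \<in> ?s"
      using assms(1) iff by (auto simp: partial_order_on_alt)
  next
    fix x y z
    assume "(x, y) \<in> ?s" "(y, z) \<in> ?s"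
    then obtain u v v' w where "(u, v) \<in> r" "(v', w) \<in> r"
        and eq: "x = \<sigma> u" "y = \<sigma> v" "y = \<sigma> v'" "z = \<sigma> w"
      by auto
    moreover from this have "v = v'"
      using r inj_onD[OF assms(2), of v v'] by auto
    ultimately have "(u, w) \<in> r"
      using assms(1) unfolding partial_order_on_alt by blast
    then show "(x, z) \<in> ?s"
      unfolding eq by (intro image_eqI[of _ _ "(u, w)"]) simp_all
  next
    fix x y
    assume xy: "(x, y) \<in> ?s" "(y, x) \<in> ?s"
    then obtain u v where "(u, v) \<in> r" and eq: "x = \<sigma> u" "y = \<sigma> v"
      by auto
    moreover from this have "(v, u) \<in> r"
      using xy(2) r iff[of v u] by auto
    ultimately have "u = v"
      using assms(1) by (simp add: partial_order_on_alt)
    then show "x = y"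
      by (simp add: eq)
  qed
qed

lemma in_poset_pcomp_iff:
  "(x, y) \<in> poset_pcomp A B a r s \<longleftrightarrow>
     (x \<in> B \<and> y \<in> B \<and> (x, y) \<in> s) \<or>
     (x \<in> A - {a} \<and> y \<in> A - {a} \<and> (x, y) \<in> r) \<or>
     (x \<in> A - {a} \<and> y \<in> B \<and> (x, a) \<in> r) \<or>
     (x \<in> B \<and> y \<in> A - {a} \<and> (a, y) \<in> r)"
  by (simp add: poset_pcomp_def)

lemma poset_pcomp_subset: "poset_pcomp A B a r s \<subseteq> (A - {a} \<union> B) \<times> (A - {a} \<union> B)"
  by (auto simp: poset_pcomp_def)

lemma partial_order_on_pcomp:
  assumes "partial_order_on A r" "partial_order_on B s" "A \<inter> B = {}" "a \<in> A"
  shows "partial_order_on (A - {a} \<union> B) (poset_pcomp A B a r s)"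
proof -
  have r: "(x, x) \<in> r" if "x \<in> A" for x
    using assms(1) that by (simp add: partial_order_on_alt)
  have s: "(x, x) \<in> s" if "x \<in> B" for x
    using assms(2) that by (simp add: partial_order_on_alt)
  have rt: "(x, y) \<in> r \<Longrightarrow> (y, z) \<in> r \<Longrightarrow> (x, z) \<in> r" for x y z
    using assms(1) unfolding partial_order_on_alt by blast
  have st: "(x, y) \<in> s \<Longrightarrow> (y, z) \<in> s \<Longrightarrow> (x, z) \<in> s" for x y z
    using assms(2) unfolding partial_order_on_alt by blast
  have ra: "(x, y) \<in> r \<Longrightarrow> (y, x) \<in> r \<Longrightarrow> x = y" for x y
    using assms(1) by (simp add: partial_order_on_alt)
  have sa: "(x, y) \<in> s \<Longrightarrow> (y, x) \<in> s \<Longrightarrow> x = y" for x y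
    using assms(2) by (simp add: partial_order_on_alt)
  show ?thesis
    unfolding partial_order_on_alt
  proof (intro conjI allI impI ballI poset_pcomp_subset)
    fix x
    assume "x \<in> A - {a} \<union> B"
    then show "(x, x) \<in> poset_pcomp A B a r s"
      using r s assms(3) by (auto simp: in_poset_pcomp_iff)
  next
    fix x y z
    assume "(x, y) \<in> poset_pcomp A B a r s" "(y, z) \<in> poset_pcomp A B a r s"
    \<comment> \<open>The delicate path leaves \<open>B\<close> and returns to it: with
      \<open>x\<close>, \<open>z\<close> in \<open>B\<close> and \<open>y\<close> in
      \<open>A - {a}\<close>, both \<open>(a, y)\<close> and \<open>(y, a)\<close> lie in
      \<open>r\<close>, so antisymmetry forces \<open>y = a\<close>, a contradiction.\<close>
    then show "(x, z) \<in> poset_pcomp A B a r s"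
      using assms(3) unfolding in_poset_pcomp_iff
      by (elim disjE conjE) (auto dest: rt st ra)
  next
    fix x y
    assume "(x, y) \<in> poset_pcomp A B a r s" "(y, x) \<in> poset_pcomp A B a r s"
    then show "x = y"
      using assms(3) unfolding in_poset_pcomp_iff
      by (elim disjE conjE) (auto dest: ra sa)
  qed
qed

lemma poset_pcomp_relabel:
  assumes "r \<subseteq> A \<times> A" "s \<subseteq> B \<times> B" "A \<inter> B = {}" "a \<in> A" "inj_on \<sigma> (A \<union> B)"
  shows "map_prod \<sigma> \<sigma> ` poset_pcomp A B a r s =
    poset_pcomp (\<sigma> ` A) (\<sigma> ` B) (\<sigma> a) (map_prod \<sigma> \<sigma> ` r) (map_prod \<sigma> \<sigma> ` s)"
proof (rule rel_image_eqI)
  let ?C = "A - {a} \<union> B"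
  have inj: "inj_on \<sigma> A" "inj_on \<sigma> B" "inj_on \<sigma> ?C"
    using assms(5) by (auto simp: inj_on_def)
  have del: "\<sigma> ` A - {\<sigma> a} = \<sigma> ` (A - {a})"
    using inj(1) assms(4) by (simp add: inj_on_image_set_diff[of \<sigma> A])
  show "inj_on \<sigma> ?C" by fact
  show "poset_pcomp A B a r s \<subseteq> ?C \<times> ?C"
    by (rule poset_pcomp_subset)
  show "poset_pcomp (\<sigma> ` A) (\<sigma> ` B) (\<sigma> a) (map_prod \<sigma> \<sigma> ` r) (map_prod \<sigma> \<sigma> ` s)
      \<subseteq> \<sigma> ` ?C \<times> \<sigma> ` ?C"
    using poset_pcomp_subset[of "\<sigma> ` A" "\<sigma> ` B" "\<sigma> a"] by (simp add: del image_Un)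
  fix x y
  assume xy: "x \<in> ?C" "y \<in> ?C"
  have B: "\<sigma> z \<in> \<sigma> ` B \<longleftrightarrow> z \<in> B" and A: "\<sigma> z \<in> \<sigma> ` (A - {a}) \<longleftrightarrow> z \<in> A - {a}" if "z \<in> ?C" for z
    using that inj_on_image_mem_iff[OF inj(3)] by auto
  note r = map_prod_image_in_iff[OF assms(1) inj(1)] and s = map_prod_image_in_iff[OF assms(2) inj(2)]
  show "(\<sigma> x, \<sigma> y) \<in> poset_pcomp (\<sigma> ` A) (\<sigma> ` B) (\<sigma> a) (map_prod \<sigma> \<sigma> ` r) (map_prod \<sigma> \<sigma> ` s)
      \<longleftrightarrow> (x, y) \<in> poset_pcomp A B a r s"
    unfolding in_poset_pcomp_iff del A[OF xy(1)] A[OF xy(2)] B[OF xy(1)] B[OF xy(2)]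
    by (simp add: r s assms(4) cong: conj_cong)
qed

interpretation poset: set_operad "\<lambda>A. {r. partial_order_on A r}"
    "\<lambda>A \<sigma> r. map_prod \<sigma> \<sigma> ` r" poset_pcomp "\<lambda>a. {(a, a)}"
proof (unfold_locales, goal_cases)
  case (2 A \<sigma> x \<tau>)
  then show ?case
    by (intro map_prod_image_cong[of _ A]) (auto simp: partial_order_on_alt)
next
  case (8 A B a \<sigma> x y)
  then show ?case
    by (intro poset_pcomp_relabel) (auto simp: partial_order_on_alt)
next
  case (9 B b y)
  then show ?case
    by (auto simp: in_poset_pcomp_iff partial_order_on_alt)
next
  case (10 A a b x)
  then have x: "x \<subseteq> A \<times> A"
    by (simp add: partial_order_on_alt)
  have "map_prod (id(a := b)) (id(a := b)) ` x = poset_pcomp A {b} a x {(b, b)}"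
  proof (rule rel_image_eqI[OF _ x])
    show "inj_on (id(a := b)) A"
      using 10 by (auto simp: inj_on_def)
    have "id(a := b) ` A = A - {a} \<union> {b}"
      using 10 by auto
    then show "poset_pcomp A {b} a x {(b, b)} \<subseteq> id(a := b) ` A \<times> id(a := b) ` A"
      using poset_pcomp_subset[of A "{b}"] by simp
    fix u v
    assume "u \<in> A" "v \<in> A"
    then show "((id(a := b)) u, (id(a := b)) v) \<in> poset_pcomp A {b} a x {(b, b)} \<longleftrightarrow> (u, v) \<in> x"
      using 10 by (auto simp: in_poset_pcomp_iff partial_order_on_alt)
  qed
  then show ?case ..
next
  case (11 A B C a b x y z)
  \<comment> \<open>The sets \<open>A\<close>, \<open>B\<close>, \<open>C\<close> and the two
    composition points cut the labels into regions. For each pair of regions both sides simplify to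
    the same condition on one of the three orders.\<close>
  then have notin: "a \<notin> B" "a \<notin> C" "b \<notin> A" "b \<notin> C" "a \<noteq> b"
    and region: "u \<in> A \<and> u \<notin> B \<and> u \<notin> C \<and> u \<noteq> a \<and> u \<noteq> b \<or> u = a \<or> u = b \<or>
      u \<in> B \<and> u \<notin> A \<and> u \<notin> C \<and> u \<noteq> a \<and> u \<noteq> b \<or> u \<in> C \<and> u \<notin> A \<and> u \<notin> B \<and> u \<noteq> a \<and> u \<noteq> b \<or>
      u \<notin> A \<and> u \<notin> B \<and> u \<notin> C" for u
    by blast+
  have "(u, v) \<in> poset_pcomp (A - {a} \<union> B) C b (poset_pcomp A B a x y) z \<longleftrightarrow>
      (u, v) \<in> poset_pcomp A (B - {b} \<union> C) a x (poset_pcomp B C b y z)" for u v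
    using region[of u] region[of v] unfolding in_poset_pcomp_iff
    by (elim disjE conjE; simp add: notin 11(7,8))
  then show ?case
    by auto
next
  case (12 A B C a a' x y z)
  then have notin: "a \<notin> B" "a \<notin> C" "a' \<notin> B" "a' \<notin> C" "a' \<noteq> a"
    and region: "u \<in> A \<and> u \<notin> B \<and> u \<notin> C \<and> u \<noteq> a \<and> u \<noteq> a' \<or> u = a \<or> u = a' \<or>
      u \<in> B \<and> u \<notin> A \<and> u \<notin> C \<and> u \<noteq> a \<and> u \<noteq> a' \<or> u \<in> C \<and> u \<notin> A \<and> u \<notin> B \<and> u \<noteq> a \<and> u \<noteq> a' \<or>
      u \<notin> A \<and> u \<notin> B \<and> u \<notin> C" for u
    by blast+
  have "(u, v) \<in> poset_pcomp (A - {a} \<union> B) C a' (poset_pcomp A B a x y) z \<longleftrightarrow>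
      (u, v) \<in> poset_pcomp (A - {a'} \<union> C) B a (poset_pcomp A C a' x z) y" for u v
    using region[of u] region[of v] unfolding in_poset_pcomp_iff
    by (elim disjE conjE; simp add: notin notin(5)[symmetric] 12(7,8))
  then show ?case
    by auto
qed (simp_all add: partial_order_on_image partial_order_on_pcomp prod.map_id0 image_comp
    map_prod_compose, simp_all add: partial_order_on_alt)


section \<open>The set operad of binary trees\<close>

lemma graft_no_leaf: "a \<notin> set (leaves t) \<Longrightarrow> graft a t u = t"
  by (induction t) auto

lemma leaves_map_leaves [simp]: "leaves (map_leaves \<sigma> t) = map \<sigma> (leaves t)"
  by (induction t) auto

lemma map_leaves_cong: "(\<And>a. a \<in> set (leaves t) \<Longrightarrow> \<sigma> a = \<tau> a) \<Longrightarrow> map_leaves \<sigma> t = map_leaves \<tau> t"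
  by (induction t) auto

lemma leaves_not_Nil [simp]: "leaves t \<noteq> []"
  by (induction t) auto

lemma set_leaves_not_empty: "set (leaves t) \<noteq> {}"
  by simp

text \<open>Distinctness puts \<open>a\<close> into exactly one of the two subtrees, and by
  \<open>graft_no_leaf\<close> the other one is not changed.\<close>

lemma set_leaves_graft:
  "a \<in> set (leaves t) \<Longrightarrow> distinct (leaves t) \<Longrightarrow>
    set (leaves (graft a t u)) = set (leaves t) - {a} \<union> set (leaves u)"
proof (induction t)
  case (Node g s t)
  then consider "a \<in> set (leaves s)" "a \<notin> set (leaves t)" | "a \<in> set (leaves t)" "a \<notin> set (leaves s)"
    by auto
  then show ?case
    by cases (use Node in \<open>auto simp: graft_no_leaf\<close>)
qed auto

lemma distinct_leaves_graft:
  "distinct (leaves t) \<Longrightarrow> distinct (leaves u) \<Longrightarrow> set (leaves t) \<inter> set (leaves u) = {} \<Longrightarrow>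
    distinct (leaves (graft a t u))"
proof (induction t)
  case (Node g s t)
  consider "a \<in> set (leaves s)" "a \<notin> set (leaves t)" | "a \<in> set (leaves t)" "a \<notin> set (leaves s)" |
    "a \<notin> set (leaves t)" "a \<notin> set (leaves s)"
    using Node.prems by auto
  then show ?case
  proof cases
    case 1
    then show ?thesis
      using Node by (simp add: graft_no_leaf set_leaves_graft) blast
  next
    case 2
    then show ?thesis
      using Node by (simp add: graft_no_leaf set_leaves_graft) blast
  qed (use Node in \<open>simp add: graft_no_leaf\<close>)
qed auto

lemma graft_graft_sequential:
  assumes "b \<notin> set (leaves t)"
  shows "graft b (graft a t u) v = graft a t (graft b u v)"
  using assms by (induction t) auto

lemma graft_graft_parallel:
  assumes "a \<noteq> b" "b \<notin> set (leaves u)" "a \<notin> set (leaves v)"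
  shows "graft b (graft a t u) v = graft a (graft b t v) u"
  using assms by (induction t) (auto simp: graft_no_leaf)

text \<open>Injectivity on the leaves together with \<open>a\<close> guarantees that no other leaf
  of \<open>t\<close> is renamed to \<open>\<sigma> a\<close>, where it would be grafted upon as
  well.\<close>

lemma map_leaves_graft:
  assumes "inj_on \<sigma> (insert a (set (leaves t)))"
  shows "map_leaves \<sigma> (graft a t u) = graft (\<sigma> a) (map_leaves \<sigma> t) (map_leaves \<sigma> u)"
  using assms
proof (induction t)
  case (Node g s t)
  then have "inj_on \<sigma> (insert a (set (leaves s)))" "inj_on \<sigma> (insert a (set (leaves t)))"
    by (auto elim: inj_on_subset)
  then show ?case
    using Node.IH by simp
qed (auto simp: inj_on_def)

lemma graft_Leaf: "graft a t (Leaf b) = map_leaves (id(a := b)) t"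
  by (induction t) auto

interpretation tree: set_operad "\<lambda>A. {t. distinct (leaves t) \<and> set (leaves t) = A}"
    "\<lambda>A. map_leaves" "\<lambda>A B. graft" Leaf
proof (unfold_locales, goal_cases)
  case (2 A \<sigma> x \<tau>)
  then show ?case
    by (intro map_leaves_cong) auto
next
  case (8 A B a \<sigma> x y)
  then have "inj_on \<sigma> (insert a (set (leaves x)))"
    by (intro inj_on_subset[OF 8(5)]) auto
  then show ?case
    by (rule map_leaves_graft)
next
  case (11 A B C a b x y z)
  then show ?case
    by (intro graft_graft_sequential) auto
next
  case (12 A B C a a' x y z)
  then show ?case
    by (intro graft_graft_parallel) auto
qed (auto simp: distinct_map btree.map_id btree.map_comp distinct_leaves_graft set_leaves_graft graft_Leaf)


section \<open>Posets without N and their decompositions\<close>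

text \<open>Three relations and three incomparabilities already force an N: reflexivity makes the
  points distinct, antisymmetry excludes the reversed relations, and the points lie in
  \<open>A\<close> because \<open>r\<close> is a relation on \<open>A\<close>.\<close>

lemma WN_iff:
  assumes "partial_order_on A r"
  shows "WN A r \<longleftrightarrow> \<not> (\<exists>x y z t. (x, z) \<in> r \<and> (y, z) \<in> r \<and> (y, t) \<in> r \<and>
    (x, y) \<notin> r \<and> (y, x) \<notin> r \<and> (x, t) \<notin> r \<and> (t, x) \<notin> r \<and> (z, t) \<notin> r \<and> (t, z) \<notin> r)"
    (is "_ \<longleftrightarrow> \<not> ?N")
proof -
  note po = partial_order_onD[OF assms]
  have refl: "(x, x) \<in> r" if "x \<in> A" for x
    using po(1) that by (auto simp: refl_on_def)
  have "(\<exists>x y z t. {x, y, z, t} \<subseteq> A \<and> distinct [x, y, z, t] \<and>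
          (\<forall>u\<in>{x, y, z, t}. \<forall>v\<in>{x, y, z, t}.
             (u, v) \<in> r \<and> u \<noteq> v \<longleftrightarrow> (u, v) \<in> {(x, z), (y, z), (y, t)})) \<longleftrightarrow> ?N"
    (is "?L \<longleftrightarrow> _")
  proof
    assume ?L
    then obtain x y z t where "{x, y, z, t} \<subseteq> A" "distinct [x, y, z, t]"
      and *: "\<forall>u\<in>{x, y, z, t}. \<forall>v\<in>{x, y, z, t}.
             (u, v) \<in> r \<and> u \<noteq> v \<longleftrightarrow> (u, v) \<in> {(x, z), (y, z), (y, t)}"
      by (elim exE conjE)
    then have "(x, z) \<in> r \<and> (y, z) \<in> r \<and> (y, t) \<in> r \<and>
        (x, y) \<notin> r \<and> (y, x) \<notin> r \<and> (x, t) \<notin> r \<and> (t, x) \<notin> r \<and> (z, t) \<notin> r \<and> (t, z) \<notin> r"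
      by auto
    then show ?N
      by blast
  next
    assume ?N
    then obtain x y z t where N: "(x, z) \<in> r" "(y, z) \<in> r" "(y, t) \<in> r"
        "(x, y) \<notin> r" "(y, x) \<notin> r" "(x, t) \<notin> r" "(t, x) \<notin> r" "(z, t) \<notin> r" "(t, z) \<notin> r"
      by (elim exE conjE)
    have A: "{x, y, z, t} \<subseteq> A"
      using N(1-3) po(4) by auto
    then have d: "distinct [x, y, z, t]"
      using N refl by auto
    then have "(z, x) \<notin> r" "(z, y) \<notin> r" "(t, y) \<notin> r"
      using N(1-3) antisymD[OF po(3)] by auto
    with N d have "\<forall>u\<in>{x, y, z, t}. \<forall>v\<in>{x, y, z, t}.
             (u, v) \<in> r \<and> u \<noteq> v \<longleftrightarrow> (u, v) \<in> {(x, z), (y, z), (y, t)}"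
      by simp
    with A d show ?L
      by blast
  qed
  then show ?thesis
    unfolding WN_def using assms by blast
qed

lemma WN_no_N:
  assumes "WN A r" "(x, z) \<in> r" "(y, z) \<in> r" "(y, t) \<in> r"
    "(x, y) \<notin> r" "(y, x) \<notin> r" "(x, t) \<notin> r" "(t, x) \<notin> r" "(z, t) \<notin> r" "(t, z) \<notin> r"
  shows False
proof -
  have "partial_order_on A r"
    using assms(1) by (simp add: WN_def)
  then show False
    using WN_iff assms by blast
qed

section \<open>Splittings into disjoint unions and ordinal sums\<close>

text \<open>The generator is a parameter so that disjoint unions and ordinal sums can be handled by
  the same lemmas. Disjointness and nonemptiness of the parts are stated separately.\<close>

definition splits :: "generator \<Rightarrow> nat set \<Rightarrow> nat set \<Rightarrow> nat rel \<Rightarrow> bool" where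
  "splits g A B r \<longleftrightarrow> (\<forall>x\<in>A. \<forall>y\<in>B. (y, x) \<notin> r \<and> ((x, y) \<in> r \<longleftrightarrow> g = Down))"

lemma splits_mono: "splits g A B r \<Longrightarrow> A' \<subseteq> A \<Longrightarrow> B' \<subseteq> B \<Longrightarrow> splits g A' B' r"
  unfolding splits_def by blast

lemma splits_M_sym: "splits M A B r \<longleftrightarrow> splits M B A r"
  unfolding splits_def by auto

text \<open>Remove a maximal element \<open>v\<close> of \<open>S\<close> and split the rest.  If that split does not extend to \<open>S\<close>,
  then the absence of N separates, inside one of the two parts, the elements below \<open>v\<close> from the others.\<close>

lemma WN_splits:
  assumes "WN A r" "finite A" "S \<subseteq> A" "x \<in> S" "y \<in> S" "x \<noteq> y"
  shows "\<exists>g S1 S2. S1 \<noteq> {} \<and> S2 \<noteq> {} \<and> S1 \<inter> S2 = {} \<and> S1 \<union> S2 = S \<and> splits g S1 S2 r"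
proof -
  have po: "partial_order_on A r"
    using assms(1) by (simp add: WN_def)
  have trans: "(a, b) \<in> r \<Longrightarrow> (b, c) \<in> r \<Longrightarrow> (a, c) \<in> r" for a b c
    using partial_order_onD(2)[OF po] by (rule transD)
  have antisym: "(a, b) \<in> r \<Longrightarrow> (b, a) \<in> r \<Longrightarrow> a = b" for a b
    using partial_order_onD(3)[OF po] by (rule antisymD)
  have refl: "a \<in> A \<Longrightarrow> (a, a) \<in> r" for a
    using partial_order_onD(1)[OF po] by (auto simp: refl_on_def)
  have "finite S"
    using assms(2,3) finite_subset by blast
  then show ?thesis
    using assms(3-6)
  proof (induction S arbitrary: x y rule: finite_psubset_induct)
    case (psubset S)
    obtain v where v: "v \<in> S" and max: "\<And>u. u \<in> S \<Longrightarrow> (v, u) \<in> r \<Longrightarrow> u = v"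
    proof -
      \<comment> \<open>A maximal element is found by minimizing the number of elements above:
        passing from \<open>v\<close> to a strictly larger element of \<open>S\<close> keeps only
        elements above \<open>v\<close> and loses \<open>v\<close> itself.\<close>
      have "\<exists>v. is_arg_min (\<lambda>v. card {u \<in> S. (v, u) \<in> r}) (\<lambda>v. v \<in> S) v"
        using psubset.hyps psubset.prems by (intro ex_is_arg_min_if_finite) auto
      then obtain v where "v \<in> S"
        and least: "\<And>w. w \<in> S \<Longrightarrow> card {u \<in> S. (v, u) \<in> r} \<le> card {u \<in> S. (w, u) \<in> r}"
        unfolding is_arg_min_linorder by blast
      have "u = v" if u: "u \<in> S" "(v, u) \<in> r" for u
      proof (rule ccontr)
        assume "u \<noteq> v"
        then have "v \<in> {w \<in> S. (v, w) \<in> r} - {w \<in> S. (u, w) \<in> r}"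
          using u \<open>v \<in> S\<close> antisym refl psubset.prems(1) by blast
        moreover have "{w \<in> S. (u, w) \<in> r} \<subseteq> {w \<in> S. (v, w) \<in> r}"
          using u trans by blast
        ultimately have "card {w \<in> S. (u, w) \<in> r} < card {w \<in> S. (v, w) \<in> r}"
          using psubset.hyps by (intro psubset_card_mono) auto
        then show False
          using least[OF u(1)] by simp
      qed
      then show thesis
        using \<open>v \<in> S\<close> that by blast
    qed
    let ?B = "S - {v}"
    let ?thesis = "\<exists>g S1 S2. S1 \<noteq> {} \<and> S2 \<noteq> {} \<and> S1 \<inter> S2 = {} \<and> S1 \<union> S2 = S \<and> splits g S1 S2 r"
    have nv: "(v, b) \<notin> r" if "b \<in> ?B" for b
      using max that by blast
    have splitI: ?thesis if "T \<noteq> {}" "T \<subset> S" "splits g T (S - T) r" for g T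
      using that by (intro exI[of _ g] exI[of _ T] exI[of _ "S - T"]) auto
    have Bne: "?B \<noteq> {}"
      using psubset.prems by blast
    show ?case
    proof (cases "\<exists>b\<in>?B. \<exists>c\<in>?B. b \<noteq> c")
      case False
      then obtain b where b: "?B = {b}"
        using Bne by blast
      \<comment> \<open>A single remaining element cannot be split, but together with
        \<open>v\<close> it forms a chain or an antichain.\<close>
      then have "splits (if (b, v) \<in> r then Down else M) {b} (S - {b}) r"
        using nv[of b] v by (auto simp: splits_def)
      then show ?thesis
        using b v by (intro splitI[of "{b}"]) auto
    next
      case True
      then obtain b c where "b \<in> ?B" "c \<in> ?B" "b \<noteq> c"
        by blast
      moreover have "?B \<subset> S" "?B \<subseteq> A"
        using v psubset.prems(1) by auto
      ultimately obtain g B1 B2 where B: "B1 \<noteq> {}" "B2 \<noteq> {}" "B1 \<inter> B2 = {}" "B1 \<union> B2 = ?B"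
        and g: "splits g B1 B2 r"
        using psubset.IH by metis
      have vB: "v \<notin> B1" "v \<notin> B2"
        using B(4) by auto
      show ?thesis
      proof (cases g)
        case Down
        then have lt: "(b1, b2) \<in> r" "(b2, b1) \<notin> r" if "b1 \<in> B1" "b2 \<in> B2" for b1 b2
          using g that by (auto simp: splits_def)
        have nv1: "(v, b) \<notin> r" if "b \<in> B1" for b
          using nv B(4) that by blast
        let ?X = "{b \<in> B1. (b, v) \<in> r}"
        have S: "S - B1 = insert v B2"
          using B(3,4) v by auto
        \<comment> \<open>An element of \<open>B2\<close> below \<open>v\<close> would put all of
          \<open>B1\<close> below \<open>v\<close> by transitivity; outside the first case no
          element of \<open>B2\<close> is below \<open>v\<close>.\<close>
        consider "?X = B1" | "?X = {}" "\<forall>b\<in>B2. (b, v) \<notin> r" | "?X \<noteq> {}" "?X \<noteq> B1" "\<forall>b\<in>B2. (b, v) \<notin> r"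
          using B(1) lt(1) trans by blast
        then show ?thesis
        proof cases
          case 1
          then have "splits Down B1 (S - B1) r"
            unfolding S splits_def using lt nv1 by blast
          then show ?thesis
            using B v by (intro splitI[of B1]) auto
        next
          case 2
          then have "splits M {v} (S - {v}) r"
            using B(4) nv by (auto simp: splits_def)
          then show ?thesis
            using v Bne by (intro splitI[of "{v}"]) auto
        next
          case 3
          have xy: "(x, y) \<in> r \<and> (y, x) \<notin> r" if xy: "x \<in> ?X" "y \<in> B1 - ?X" for x y
          proof -
            obtain b where b: "b \<in> B2"
              using B(2) by blast
            have yx: "(y, x) \<notin> r"
              using xy trans by blast
            \<comment> \<open>If \<open>x\<close> and \<open>y\<close> were incomparable, the
              relations y < b, x < b, x < v would form an N. Thus \<open>?X\<close> lies below
              everything else in \<open>S\<close>.\<close>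
            have "(x, y) \<in> r"
            proof (rule ccontr)
              assume "(x, y) \<notin> r"
              moreover have "(y, b) \<in> r" "(x, b) \<in> r" "(x, v) \<in> r" "(y, v) \<notin> r" "(b, v) \<notin> r"
                using xy b lt 3(3) by auto
              moreover have "(v, y) \<notin> r" "(v, b) \<notin> r"
                using nv B(4) xy b by auto
              ultimately show False
                using WN_no_N[OF assms(1), of y b x v] yx by blast
            qed
            with yx show ?thesis
              by blast
          qed
          have "(y, x) \<notin> r \<and> ((x, y) \<in> r \<longleftrightarrow> Down = Down)" if x: "x \<in> ?X" and y: "y \<in> S - ?X" for x y
          proof -
            have "x \<in> B1" "(x, v) \<in> r"
              using x by auto
            then have facts: "x \<in> B1" "(x, v) \<in> r" "(v, x) \<notin> r"
              using nv1 by simp_all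
            consider "y \<in> B1 - ?X" | "y = v" | "y \<in> B2"
              using B(4) y by blast
            then show ?thesis
              by cases (use facts xy[OF x, of y] lt[of x y] in simp_all)
          qed
          then have "splits Down ?X (S - ?X) r"
            unfolding splits_def by blast
          then show ?thesis
            using 3 v B(4) vB by (intro splitI[of ?X]) auto
        qed
      next
        case M
        \<comment> \<open>Formulated for an arbitrary pair \<open>C1\<close>, \<open>C2\<close>,
          because it is applied to \<open>B1\<close> and \<open>B2\<close> in both orders. The part
          split off is the set of elements of \<open>C1\<close> not below \<open>v\<close>, which
          turns out to be unrelated to the rest of \<open>S\<close>.\<close>
        have parallel: "?thesis" if C: "C1 \<inter> C2 = {}" "C1 \<union> C2 = ?B"
            and g: "splits M C1 C2 r" and y: "y \<in> C1" "(y, v) \<notin> r"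
            and z: "z \<in> C2" "(z, v) \<in> r" for C1 C2 y z
        proof -
          let ?Y = "{b \<in> C1. (b, v) \<notin> r}"
          have par: "(b1, b2) \<notin> r" "(b2, b1) \<notin> r" if "b1 \<in> C1" "b2 \<in> C2" for b1 b2
            using g that by (auto simp: splits_def)
          have "(b, c) \<notin> r \<and> (c, b) \<notin> r" if bc: "b \<in> ?Y" "c \<in> C1 - ?Y" for b c
          proof
            show "(b, c) \<notin> r"
              using bc trans by blast
            \<comment> \<open>Otherwise z < v, c < v, c < b would form an N; the element
              \<open>z\<close> of the other part is what makes it available.\<close>
            show "(c, b) \<notin> r"
            proof
              assume "(c, b) \<in> r"
              moreover have "(c, v) \<in> r" "(z, v) \<in> r"
                using bc z by auto
              moreover have "(b, v) \<notin> r" "(v, b) \<notin> r"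
                using bc nv C(2) by auto
              moreover have "(z, c) \<notin> r" "(c, z) \<notin> r" "(z, b) \<notin> r" "(b, z) \<notin> r"
                using par bc z by auto
              ultimately show False
                using WN_no_N[OF assms(1), of z v c b] by blast
            qed
          qed
          note in_C1 = this
          have "(c, b) \<notin> r \<and> ((b, c) \<in> r \<longleftrightarrow> M = Down)" if b: "b \<in> ?Y" and c: "c \<in> S - ?Y" for b c
          proof -
            have "b \<in> C1" "b \<in> ?B" "(b, v) \<notin> r"
              using b C(2) by auto
            then have facts: "b \<in> C1" "(b, v) \<notin> r" "(v, b) \<notin> r"
              using nv by simp_all
            consider "c \<in> C1 - ?Y" | "c = v" | "c \<in> C2"
              using C(2) c by blast
            then show ?thesis
              by cases (use facts in_C1[OF b, of c] par[of b c] in simp_all)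
          qed
          then have "splits M ?Y (S - ?Y) r"
            unfolding splits_def by blast
          moreover have "v \<notin> ?Y"
            using C(2) by auto
          ultimately show ?thesis
            using y v C(2) by (intro splitI[of ?Y]) auto
        qed
        \<comment> \<open>Outside the first three cases some element is not below \<open>v\<close>,
          while each part contains one that is; the latter is taken from the part not containing the
          former.\<close>
        consider "\<forall>b\<in>B1. (b, v) \<notin> r" | "\<forall>b\<in>B2. (b, v) \<notin> r" | "\<forall>b\<in>?B. (b, v) \<in> r"
          | y z where "y \<in> B1" "(y, v) \<notin> r" "z \<in> B2" "(z, v) \<in> r"
          | y z where "y \<in> B2" "(y, v) \<notin> r" "z \<in> B1" "(z, v) \<in> r"
          using B(4) by blast
        then show ?thesis
        proof cases
          case 1
          have "S - B1 = insert v B2"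
            using B(3,4) v by auto
          moreover have "(v, b) \<notin> r" if "b \<in> B1" for b
            using nv B(4) that by blast
          ultimately have "splits M B1 (S - B1) r"
            using g 1 M by (auto simp: splits_def)
          then show ?thesis
            using B(1,4) v by (intro splitI[of B1]) auto
        next
          case 2
          have "S - B2 = insert v B1"
            using B(3,4) v by auto
          moreover have "(v, b) \<notin> r" if "b \<in> B2" for b
            using nv B(4) that by blast
          ultimately have "splits M B2 (S - B2) r"
            using g 2 M by (auto simp: splits_def)
          then show ?thesis
            using B(2,4) v by (intro splitI[of B2]) auto
        next
          case 3
          have "S - ?B = {v}"
            using v by auto
          then have "splits Down ?B (S - ?B) r"
            using 3 nv by (auto simp: splits_def)
          then show ?thesis
            using v Bne by (intro splitI[of ?B]) auto
        next
          case 4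
          then show ?thesis
            using parallel[of B1 B2] B(3,4) g M by blast
        next
          case 5
          then show ?thesis
            using parallel[of B2 B1] B(3,4) g M splits_M_sym by (metis Int_commute Un_commute)
        qed
      qed
    qed
  qed
qed


section \<open>Trees representing a poset\<close>

text \<open>No transitive closure is needed: \<open>Down\<close> relates every leaf on the left to
  every leaf on the right.\<close>

primrec tree_poset :: "(generator, nat) btree \<Rightarrow> nat rel" where
  "tree_poset (Leaf a) = {(a, a)}"
| "tree_poset (Node g s t) = tree_poset s \<union> tree_poset t \<union>
    (if g = Down then set (leaves s) \<times> set (leaves t) else {})"

lemma tree_poset_subset: "tree_poset t \<subseteq> set (leaves t) \<times> set (leaves t)"
  by (induction t) auto

lemma in_tree_posetD:
  "(x, y) \<in> tree_poset t \<Longrightarrow> x \<in> set (leaves t) \<and> y \<in> set (leaves t)"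
  using tree_poset_subset by blast

text \<open>The memberships in the leaf sets are repeated in each disjunct, so that disjointness of
  the two subtrees excludes the mixed cases propositionally.\<close>

lemma in_tree_poset_Node:
  "(x, y) \<in> tree_poset (Node g s t) \<longleftrightarrow>
    x \<in> set (leaves s) \<and> y \<in> set (leaves s) \<and> (x, y) \<in> tree_poset s \<or>
    x \<in> set (leaves t) \<and> y \<in> set (leaves t) \<and> (x, y) \<in> tree_poset t \<or>
    g = Down \<and> x \<in> set (leaves s) \<and> y \<in> set (leaves t)"
  using in_tree_posetD[of x y s] in_tree_posetD[of x y t] by auto

lemma partial_order_on_tree_poset:
  "distinct (leaves t) \<Longrightarrow> partial_order_on (set (leaves t)) (tree_poset t)"
proof (induction t)
  case (Node g s t)
  let ?S = "set (leaves s)" and ?T = "set (leaves t)"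
  have disj: "?S \<inter> ?T = {}"
    using Node.prems by auto
  have s: "partial_order_on ?S (tree_poset s)" and t: "partial_order_on ?T (tree_poset t)"
    using Node by auto
  note s = partial_order_onD[OF s] and t = partial_order_onD[OF t]
  have *: "refl_on (?S \<union> ?T) (tree_poset (Node g s t))"
    using s(1) t(1) by (auto simp: refl_on_def)
  have **: "trans (tree_poset (Node g s t))"
    unfolding trans_def in_tree_poset_Node
    by (intro allI impI; elim disjE conjE; use disj in \<open>blast dest: transD[OF s(2)] transD[OF t(2)]\<close>)
  have "antisym (tree_poset (Node g s t))"
    unfolding antisym_def in_tree_poset_Node
    by (intro allI impI; elim disjE conjE; use disj in \<open>blast dest: antisymD[OF s(3)] antisymD[OF t(3)]\<close>)
  then show ?case
    using * ** tree_poset_subset[of "Node g s t"]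
    unfolding partial_order_on_def preorder_on_def by simp
qed (auto simp: partial_order_on_def preorder_on_def refl_on_def trans_def antisym_def)

text \<open>N and its incomparability graph are both connected, so an N inside the poset of a node lies
  inside that of one of the two subtrees.\<close>

lemma WN_tree_poset: "distinct (leaves t) \<Longrightarrow> WN (set (leaves t)) (tree_poset t)"
proof (induction t)
  case (Leaf a)
  have "partial_order_on {a} {(a, a)}"
    by (simp add: partial_order_on_alt)
  then show ?case
    by (simp add: WN_iff)
next
  case (Node g s t)
  let ?S = "set (leaves s)" and ?T = "set (leaves t)" and ?r = "tree_poset (Node g s t)"
  have disj: "?S \<inter> ?T = {}" and s: "WN ?S (tree_poset s)" and t: "WN ?T (tree_poset t)"
    using Node by auto
  have rs: "(x, y) \<in> ?r \<longleftrightarrow> (x, y) \<in> tree_poset s" if "x \<in> ?S" "y \<in> ?S" for x y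
    using that disj unfolding in_tree_poset_Node by blast+
  have rt: "(x, y) \<in> ?r \<longleftrightarrow> (x, y) \<in> tree_poset t" if "x \<in> ?T" "y \<in> ?T" for x y
    using that disj unfolding in_tree_poset_Node by blast+
  have rst: "(x, y) \<in> ?r \<longleftrightarrow> g = Down" "(y, x) \<notin> ?r" if "x \<in> ?S" "y \<in> ?T" for x y
    using that disj unfolding in_tree_poset_Node by blast+
  have po: "partial_order_on (?S \<union> ?T) ?r"
    using partial_order_on_tree_poset[OF Node.prems] by simp
  have False if N: "(x, z) \<in> ?r" "(y, z) \<in> ?r" "(y, w) \<in> ?r" "(x, y) \<notin> ?r" "(y, x) \<notin> ?r"
      "(x, w) \<notin> ?r" "(w, x) \<notin> ?r" "(z, w) \<notin> ?r" "(w, z) \<notin> ?r" for x y z w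
  proof -
    have mem: "x \<in> ?S \<union> ?T" "y \<in> ?S \<union> ?T" "z \<in> ?S \<union> ?T" "w \<in> ?S \<union> ?T"
      using N(1-3) in_tree_posetD[of _ _ "Node g s t"] by auto
    \<comment> \<open>Pairs from different subtrees are always comparable for \<open>Down\<close>
      and never for \<open>M\<close>; a pair behaving otherwise stays in one subtree.\<close>
    have same: "a \<in> ?S \<longleftrightarrow> b \<in> ?S" if "a \<in> ?S \<union> ?T" "b \<in> ?S \<union> ?T"
        "g = Down \<longrightarrow> (a, b) \<notin> ?r \<and> (b, a) \<notin> ?r" "g \<noteq> Down \<longrightarrow> (a, b) \<in> ?r \<or> (b, a) \<in> ?r" for a b
      using that rst disj by blast
    have "(x \<in> ?S \<and> y \<in> ?S \<and> z \<in> ?S \<and> w \<in> ?S) \<or> (x \<in> ?T \<and> y \<in> ?T \<and> z \<in> ?T \<and> w \<in> ?T)"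
    proof (cases "g = Down")
      case True
      then show ?thesis
        using same[of x y] same[of x w] same[of z w] mem N disj by blast
    next
      case False
      then show ?thesis
        using same[of x z] same[of y z] same[of y w] mem N disj by blast
    qed
    then show False
    proof
      assume "x \<in> ?S \<and> y \<in> ?S \<and> z \<in> ?S \<and> w \<in> ?S"
      then show False
        using N rs WN_no_N[OF s, of x z y w] by blast
    next
      assume "x \<in> ?T \<and> y \<in> ?T \<and> z \<in> ?T \<and> w \<in> ?T"
      then show False
        using N rt WN_no_N[OF t, of x z y w] by blast
    qed
  qed
  then have "WN (?S \<union> ?T) ?r"
    unfolding WN_iff[OF po] by blast
  then show ?case
    by simp
qed

section \<open>Existence of trees for all subsets of a poset without N\<close>

text \<open>Only \<open>S\<close> changes when a decomposition is refined; \<open>r\<close> remains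
  the order of the whole poset, so that the absence of N is assumed once and no induced orders have
  to be carried along.\<close>

definition represents :: "nat rel \<Rightarrow> nat set \<Rightarrow> (generator, nat) btree \<Rightarrow> bool" where
  "represents r S t \<longleftrightarrow> distinct (leaves t) \<and> set (leaves t) = S \<and> tree_poset t = r \<inter> S \<times> S"

text \<open>Translates the root of a tree into a splitting of \<open>S\<close>; the arguments for
  existence and uniqueness then concern sets and the fixed relation only.\<close>

lemma represents_Node:
  "represents r S (Node g t1 t2) \<longleftrightarrow>
    represents r (set (leaves t1)) t1 \<and> represents r (set (leaves t2)) t2 \<and>
    set (leaves t1) \<inter> set (leaves t2) = {} \<and> set (leaves t1) \<union> set (leaves t2) = S \<and>
    splits g (set (leaves t1)) (set (leaves t2)) r"
proof (cases "set (leaves t1) \<inter> set (leaves t2) = {} \<and> set (leaves t1) \<union> set (leaves t2) = S")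
  case True
  let ?S = "set (leaves t1)" and ?T = "set (leaves t2)"
  have "tree_poset (Node g t1 t2) = r \<inter> S \<times> S \<longleftrightarrow>
      tree_poset t1 = r \<inter> ?S \<times> ?S \<and> tree_poset t2 = r \<inter> ?T \<times> ?T \<and> splits g ?S ?T r"
  proof
    assume r: "tree_poset (Node g t1 t2) = r \<inter> S \<times> S"
    have *: "(x, y) \<in> r \<longleftrightarrow> (x, y) \<in> tree_poset (Node g t1 t2)" if "x \<in> S" "y \<in> S" for x y
      using that r by blast
    have "(x, y) \<in> tree_poset t1 \<longleftrightarrow> (x, y) \<in> r \<inter> ?S \<times> ?S" for x y
      using True *[of x y] in_tree_posetD[of x y t1] unfolding in_tree_poset_Node by blast
    moreover have "(x, y) \<in> tree_poset t2 \<longleftrightarrow> (x, y) \<in> r \<inter> ?T \<times> ?T" for x y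
      using True *[of x y] in_tree_posetD[of x y t2] unfolding in_tree_poset_Node by blast
    moreover have "splits g ?S ?T r"
      using True * unfolding splits_def in_tree_poset_Node by blast
    ultimately show "tree_poset t1 = r \<inter> ?S \<times> ?S \<and> tree_poset t2 = r \<inter> ?T \<times> ?T \<and> splits g ?S ?T r"
      by auto
  next
    assume "tree_poset t1 = r \<inter> ?S \<times> ?S \<and> tree_poset t2 = r \<inter> ?T \<times> ?T \<and> splits g ?S ?T r"
    then show "tree_poset (Node g t1 t2) = r \<inter> S \<times> S"
      using True unfolding splits_def by auto
  qed
  then show ?thesis
    using True unfolding represents_def by auto
next
  case False
  moreover have "set (leaves t1) \<inter> set (leaves t2) = {} \<and> set (leaves t1) \<union> set (leaves t2) = S"
    if "represents r S (Node g t1 t2)"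
    using that by (simp add: represents_def)
  ultimately show ?thesis
    by blast
qed

lemma represents_leaves: "represents r S t \<Longrightarrow> set (leaves t) = S"
  by (simp add: represents_def)

lemma represents_self: "distinct (leaves t) \<Longrightarrow> represents (tree_poset t) (set (leaves t)) t"
  using tree_poset_subset by (auto simp: represents_def)

lemma represents_NodeI:
  "represents r S1 t1 \<Longrightarrow> represents r S2 t2 \<Longrightarrow> S1 \<inter> S2 = {} \<Longrightarrow> splits g S1 S2 r \<Longrightarrow>
    represents r (S1 \<union> S2) (Node g t1 t2)"
  unfolding represents_Node using represents_leaves[of r S1 t1] represents_leaves[of r S2 t2] by simp

text \<open>Subsets of \<open>A\<close> are included because the uniqueness proof needs trees for
  the pieces of a common refinement, which need not be leaf sets of subtrees of the given
  trees.\<close>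

lemma represents_exists:
  assumes "WN A r" "finite A" "S \<subseteq> A" "S \<noteq> {}"
  shows "\<exists>t. represents r S t"
proof -
  have "finite S"
    using assms(2,3) finite_subset by blast
  then show ?thesis
    using assms(3,4)
  proof (induction S rule: finite_psubset_induct)
    case (psubset S)
    show ?case
    proof (cases "\<exists>x\<in>S. \<exists>y\<in>S. x \<noteq> y")
      case False
      then obtain a where a: "S = {a}"
        using psubset.prems by blast
      moreover have "(a, a) \<in> r"
        using psubset.prems a assms(1) by (auto simp: WN_def partial_order_on_def preorder_on_def refl_on_def)
      ultimately have "represents r S (Leaf a)"
        by (auto simp: represents_def)
      then show ?thesis ..
    next
      case True
      then obtain x y where "x \<in> S" "y \<in> S" "x \<noteq> y"
        by blast
      then obtain g S1 S2 where S: "S1 \<noteq> {}" "S2 \<noteq> {}" "S1 \<inter> S2 = {}" "S1 \<union> S2 = S" "splits g S1 S2 r"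
        using WN_splits[OF assms(1,2) psubset.prems(1)] by metis
      then have "S1 \<subset> S" "S2 \<subset> S"
        by auto
      then obtain t1 t2 where "represents r S1 t1" "represents r S2 t2"
        using psubset.IH[of S1] psubset.IH[of S2] psubset.prems(1) S by blast
      then show ?thesis
        using represents_NodeI S by blast
    qed
  qed
qed

corollary WN_eq_tree_posets:
  assumes "label_set A"
  shows "{r. WN A r} = tree_poset ` {t. distinct (leaves t) \<and> set (leaves t) = A}"
proof (intro subset_antisym subsetI)
  fix r
  assume "r \<in> {r. WN A r}"
  then have r: "WN A r"
    by simp
  then obtain t where "represents r A t"
    using represents_exists[OF r] assms by blast
  moreover have "r \<subseteq> A \<times> A"
    using r by (simp add: WN_def partial_order_onD)
  ultimately show "r \<in> tree_poset ` {t. distinct (leaves t) \<and> set (leaves t) = A}"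
    unfolding represents_def by (intro image_eqI[of _ _ t]) auto
qed (auto simp: WN_tree_poset)

section \<open>Uniqueness of the tree up to associativity and commutativity\<close>

text \<open>A purely combinatorial intermediate between equality of posets and congruence modulo an
  ideal. It carries no label sets; these are recovered by \<open>tree_eq_leaves\<close>.\<close>

inductive tree_eq :: "(generator, nat) btree \<Rightarrow> (generator, nat) btree \<Rightarrow> bool" where
  refl: "tree_eq t t"
| sym: "tree_eq s t \<Longrightarrow> tree_eq t s"
| trans: "tree_eq s t \<Longrightarrow> tree_eq t u \<Longrightarrow> tree_eq s u"
| cong: "tree_eq s s' \<Longrightarrow> tree_eq t t' \<Longrightarrow> tree_eq (Node g s t) (Node g s' t')"
| comm: "tree_eq (Node M s t) (Node M t s)"
| assoc: "tree_eq (Node g (Node g s t) u) (Node g s (Node g t u))"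

text \<open>Keeps every intermediate tree of a chain of rewritings in the same component of the free
  operad.\<close>

lemma tree_eq_leaves:
  "tree_eq s t \<Longrightarrow>
    set (leaves s) = set (leaves t) \<and> (distinct (leaves s) \<longleftrightarrow> distinct (leaves t))"
  by (induction rule: tree_eq.induct) (simp_all, blast+)

text \<open>An ordinal sum has a connected comparability graph, a disjoint union does not.
  Concretely, comparable points \<open>p\<close> and \<open>q\<close> from the two ordinal summands
  lie on one side of the disjoint union, and a point \<open>b\<close> of the other side is
  comparable with one of them.\<close>

lemma splits_same_gen:
  assumes "splits g S T r" "splits g' S' T' r" "S \<union> T = S' \<union> T'"
    and "S \<noteq> {}" "T \<noteq> {}" "S' \<noteq> {}" "T' \<noteq> {}"
  shows "g = g'"
proof -
  have False if *: "splits M S T r" "splits Down S' T' r" "S \<union> T = S' \<union> T'"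
      "S \<noteq> {}" "T \<noteq> {}" "S' \<noteq> {}" "T' \<noteq> {}" for S T S' T'
  proof -
    have un: "(x, y) \<notin> r" "(y, x) \<notin> r" if "x \<in> S" "y \<in> T" for x y
      using *(1) that by (auto simp: splits_def)
    have dn: "(x, y) \<in> r" if "x \<in> S'" "y \<in> T'" for x y
      using *(2) that by (auto simp: splits_def)
    obtain p q where pq: "p \<in> S'" "q \<in> T'"
      using *(6,7) by blast
    then consider "p \<in> S" "q \<in> S" | "p \<in> T" "q \<in> T"
      using *(3) un[of p q] un[of q p] dn[of p q] by blast
    then show False
    proof cases
      case 1
      obtain b where b: "b \<in> T" "b \<in> S' \<or> b \<in> T'"
        using *(3,5) by blast
      then show False
        using 1 pq un[of q b] un[of p b] dn[of b q] dn[of p b] by blast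
    next
      case 2
      obtain b where b: "b \<in> S" "b \<in> S' \<or> b \<in> T'"
        using *(3,4) by blast
      then show False
        using 2 pq un[of b q] un[of b p] dn[of b q] dn[of p b] by blast
    qed
  qed
  then show ?thesis
    using assms by (cases g; cases g'; metis)
qed

theorem represents_unique:
  assumes "WN A r" "finite A" "S \<subseteq> A" "represents r S t" "represents r S t'"
  shows "tree_eq t t'"
proof -
  have "finite S"
    using assms(2,3) finite_subset by blast
  then show ?thesis
    using assms(3-)
  proof (induction S arbitrary: t t' rule: finite_psubset_induct)
    case (psubset S)
    let ?L = "\<lambda>t. set (leaves t)"
    have psubset_split: "X \<subset> U" "Y \<subset> U"
      if "X \<noteq> {}" "Y \<noteq> {}" "X \<inter> Y = {}" "X \<union> Y = U" for X Y U :: "nat set"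
      using that by auto
    \<comment> \<open>With a tree \<open>u\<close> on the difference of the first parts, the
      induction hypothesis rewrites \<open>s1\<close> to \<open>Node g t1 u\<close> and
      \<open>t2\<close> to \<open>Node g u s2\<close>; one application of associativity joins the
      two.\<close>
    have nested: "tree_eq (Node g t1 t2) (Node g s1 s2)"
      if t: "represents r S (Node g t1 t2)" and s: "represents r S (Node g s1 s2)"
        and sub: "?L t1 \<subseteq> ?L s1" for g t1 t2 s1 s2
    proof -
      note t = t[unfolded represents_Node] and s = s[unfolded represents_Node]
      have psub: "?L s1 \<subset> S" "?L t2 \<subset> S" "?L t1 \<subset> S" "?L s2 \<subset> S"
        using s t psubset_split[OF set_leaves_not_empty set_leaves_not_empty] by metis+
      then have subA: "?L s1 \<subseteq> A" "?L t2 \<subseteq> A" "?L t1 \<subseteq> A" "?L s2 \<subseteq> A"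
        using psubset.prems(1) by auto
      show ?thesis
      proof (cases "?L t1 = ?L s1")
        case True
        moreover from this have "?L t2 = ?L s2"
          using s t by auto
        ultimately show ?thesis
          using psubset.IH psub subA s t by (metis tree_eq.cong)
      next
        case False
        let ?C = "?L s1 - ?L t1"
        have C: "?L t1 \<union> ?C = ?L s1" "?C \<union> ?L s2 = ?L t2" "?L t1 \<inter> ?C = {}" "?C \<inter> ?L s2 = {}"
          using s t sub by auto
        have "?C \<subseteq> A" "?C \<noteq> {}"
          using False sub subA by auto
        then obtain u where u: "represents r ?C u"
          using represents_exists[OF assms(1,2)] by blast
        have "splits g (?L t1) ?C r" "splits g ?C (?L s2) r"
          using s t C(2) by (auto intro: splits_mono)
        then have "represents r (?L s1) (Node g t1 u)" "represents r (?L t2) (Node g u s2)"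
          using represents_NodeI[of r "?L t1" t1 ?C u g] represents_NodeI[of r ?C u "?L s2" s2 g] s t u C
          by simp_all
        then have "tree_eq s1 (Node g t1 u)" "tree_eq t2 (Node g u s2)"
          using psubset.IH[OF psub(1) subA(1)] psubset.IH[OF psub(2) subA(2)] s t by simp_all
        then show ?thesis
          by (meson tree_eq.intros)
      qed
    qed
    have single: "\<exists>a. v = Leaf a" if "represents r {a} v" for a v
    proof (cases v)
      case (Node g v1 v2)
      with that have "represents r {a} (Node g v1 v2)"
        by (simp only:)
      then have v: "?L v1 \<inter> ?L v2 = {} \<and> ?L v1 \<union> ?L v2 = {a}"
        by (simp only: represents_Node simp_thms)
      have "?L v1 \<subset> {a}"
        by (rule psubset_split(1)[OF set_leaves_not_empty set_leaves_not_empty conjunct1[OF v] conjunct2[OF v]])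
      then have "?L v1 = {}"
        using subset_singletonD[of "?L v1" a] by (simp add: psubset_eq)
      then show ?thesis
        by simp
    qed simp
    show ?case
    proof (cases t)
      case (Leaf a)
      then have "S = {a}"
        using psubset.prems by (auto simp: represents_def)
      then show ?thesis
        using single[of a t'] psubset.prems Leaf by (auto simp: represents_def intro: tree_eq.refl)
    next
      case t: (Node g t1 t2)
      show ?thesis
      proof (cases t')
        case (Leaf a)
        then have "S = {a}"
          using psubset.prems by (auto simp: represents_def)
        then show ?thesis
          using single[of a t] psubset.prems Leaf by (auto simp: represents_def intro: tree_eq.refl)
      next
        case t': (Node g' s1 s2)
        note rt = psubset.prems(2)[unfolded t represents_Node]
          and rs = psubset.prems(3)[unfolded t' represents_Node]
        have g: "g' = g"
          by (rule splits_same_gen[of g' "?L s1" "?L s2" r _ "?L t1" "?L t2"]) (use rt rs in auto)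
        show ?thesis
        proof (cases g)
          case Down
          \<comment> \<open>If p lay only in the first part of \<open>t\<close> and q only in that
            of \<open>t'\<close>, the two ordinal sums would give both p < q and q < p.\<close>
          have "?L t1 \<subseteq> ?L s1 \<or> ?L s1 \<subseteq> ?L t1"
            using rt rs unfolding g Down splits_def by blast
          then show ?thesis
            using nested[of g t1 t2 s1 s2] nested[of g s1 s2 t1 t2] psubset.prems tree_eq.sym
            unfolding t t' g by blast
        next
          case M
          obtain a where a: "a \<in> ?L t1"
            using leaves_not_Nil[of t1] by (metis list.set_sel(1))
          \<comment> \<open>Flips \<open>t'\<close> if necessary, so that the two first parts share
            the element \<open>a\<close> and their intersection is nonempty.\<close>
          obtain s1' s2' where s': "represents r S (Node M s1' s2')" "a \<in> ?L s1'"
              "tree_eq t' (Node M s1' s2')"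
          proof (cases "a \<in> ?L s1")
            case True
            then show thesis
              using that[of s1 s2] psubset.prems(3) t' g M tree_eq.refl by simp
          next
            case False
            have "represents r S (Node M s2 s1)"
              using rs g M splits_M_sym by (auto simp: represents_Node)
            moreover have "a \<in> ?L s1 \<union> ?L s2"
              using a rt rs by auto
            then have "a \<in> ?L s2"
              using False by simp
            moreover have "tree_eq t' (Node M s2 s1)"
              unfolding t' g M by (rule tree_eq.comm)
            ultimately show thesis
              by (rule that)
          qed
          note rs' = s'(1)[unfolded represents_Node]
          let ?D = "?L t1 \<inter> ?L s1'"
          obtain b where b: "b \<in> ?L t2"
            using set_leaves_not_empty[of t2] by (meson ex_in_conv)
          have t12: "?L t1 \<inter> ?L t2 = {}" "?L t1 \<union> ?L t2 = S"
            using rt by iprover+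
          have "?D \<noteq> {}"
            using a s'(2) by blast
          moreover have "?D \<subseteq> A" "S - ?D \<subseteq> A"
            using t12(2) psubset.prems(1) by blast+
          moreover have "S - ?D \<noteq> {}"
            using b t12 by blast
          ultimately obtain w w' where w: "represents r ?D w" "represents r (S - ?D) w'"
            using represents_exists[OF assms(1,2)] by meson
          \<comment> \<open>A point outside \<open>?D\<close> lies in the second part of one of the
            two splittings, hence is incomparable with all of \<open>?D\<close>. As
            \<open>?D\<close> is contained in both first parts, \<open>nested\<close> links the tree
            \<open>Node M w w'\<close> with each of the two trees.\<close>
          have "splits M ?D (S - ?D) r"
            using rt rs' M unfolding splits_def by (metis (no_types, lifting) DiffE IntE IntI UnE)
          moreover have "?D \<union> (S - ?D) = S"
            using t12(2) by blast
          ultimately have W: "represents r S (Node M w w')"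
            using represents_NodeI[OF w] by simp
          have "tree_eq (Node M w w') (Node M s1' s2')" "tree_eq (Node M w w') t"
            using nested[OF W s'(1)] nested[OF W psubset.prems(2)[unfolded t M]] represents_leaves[OF w(1)]
            unfolding t M by simp_all
          then show ?thesis
            using s'(3) by (meson tree_eq.sym tree_eq.trans)
        qed
      qed
    qed
  qed
qed


section \<open>From trees to posets without N\<close>

text \<open>Relabelling, composition and units of a linearization do not depend on the family of
  components, so the operad axioms for the smaller family supply the closure conditions of a
  suboperad.\<close>

lemma suboperad_linearization:
  assumes "set_operad X rl cmp un" "set_operad Y rl cmp un" "\<And>A. label_set A \<Longrightarrow> Y A \<subseteq> X A"
  shows "suboperad (linearization X rl cmp un :: ('k::field, 'b \<Rightarrow>\<^sub>0 'k) operad_data)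
    (\<lambda>A. {f. Poly_Mapping.keys f \<subseteq> Y A})"
proof -
  let ?Q = "linearization Y rl cmp un :: ('k, 'b \<Rightarrow>\<^sub>0 'k) operad_data"
  interpret Q: operad ?Q
    using assms(2) by (rule set_operad.operad_linearization)
  show ?thesis
    unfolding suboperad_def
    using set_operad.operad_linearization[OF assms(1)] assms(3)
      Q.subspace Q.relabel_closed Q.unit_closed Q.pcomp_closed by simp blast
qed

lemma tree_poset_map_leaves: "tree_poset (map_leaves \<sigma> t) = map_prod \<sigma> \<sigma> ` tree_poset t"
proof (induction t)
  case (Node g s t)
  have "map_prod \<sigma> \<sigma> ` (X \<times> Y) = \<sigma> ` X \<times> \<sigma> ` Y" for X Y
    by (auto simp: image_iff)
  then show ?case
    using Node by (simp add: image_Un)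
qed simp

text \<open>The leaves of \<open>u\<close> inherit the relations of the leaf \<open>a\<close> that
  they replace. As \<open>a\<close> occurs in one subtree only, the induction hypothesis is applied
  there and the other subtree stays fixed.\<close>

lemma tree_poset_graft:
  "distinct (leaves t) \<Longrightarrow> a \<in> set (leaves t) \<Longrightarrow> set (leaves t) \<inter> set (leaves u) = {} \<Longrightarrow>
    tree_poset (graft a t u) =
    poset_pcomp (set (leaves t)) (set (leaves u)) a (tree_poset t) (tree_poset u)"
proof (induction t)
  case (Leaf b)
  then show ?case
    using in_tree_posetD[of _ _ u] by (auto simp: in_poset_pcomp_iff)
next
  case (Node g s t)
  let ?S = "set (leaves s)" and ?T = "set (leaves t)" and ?U = "set (leaves u)"
  have disj: "?S \<inter> ?T = {}" "?S \<inter> ?U = {}" "?T \<inter> ?U = {}" "distinct (leaves s)" "distinct (leaves t)"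
    using Node.prems by auto
  then have region: "x \<in> ?S \<and> x \<notin> ?T \<and> x \<notin> ?U \<and> x \<noteq> a \<or> x = a \<or>
      x \<in> ?T \<and> x \<notin> ?S \<and> x \<notin> ?U \<and> x \<noteq> a \<or> x \<in> ?U \<and> x \<notin> ?S \<and> x \<notin> ?T \<or>
      x \<notin> ?S \<and> x \<notin> ?T \<and> x \<notin> ?U \<and> x \<noteq> a" for x
    by blast
  have U: "a \<notin> ?U"
    using Node.prems by auto
  have "(x, y) \<in> tree_poset (graft a (Node g s t) u) \<longleftrightarrow>
      (x, y) \<in> poset_pcomp (?S \<union> ?T) ?U a (tree_poset (Node g s t)) (tree_poset u)" for x y
  proof (cases "a \<in> ?S")
    case True
    then have T: "a \<notin> ?T"
      using disj by auto
    have graft: "graft a (Node g s t) u = Node g (graft a s u) t"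
      using T by (simp add: graft_no_leaf)
    show ?thesis
      unfolding graft in_tree_poset_Node Node.IH(1)[OF disj(4) True disj(2)]
        set_leaves_graft[OF True disj(4)] in_poset_pcomp_iff
      using region[of x] region[of y] by (elim disjE conjE; simp add: True T U)
  next
    case False
    then have T: "a \<in> ?T"
      using Node.prems by auto
    have graft: "graft a (Node g s t) u = Node g s (graft a t u)"
      using False by (simp add: graft_no_leaf)
    show ?thesis
      unfolding graft in_tree_poset_Node Node.IH(2)[OF disj(5) T disj(3)]
        set_leaves_graft[OF T disj(5)] in_poset_pcomp_iff
      using region[of x] region[of y] by (elim disjE conjE; simp add: False T U)
  qed
  then show ?case
    unfolding leaves.simps set_append by (intro set_eqI) (simp only: split_paired_all)
qed

lemma WN_treeE:
  assumes "WN A r" "label_set A"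
  obtains t where "distinct (leaves t)" "set (leaves t) = A" "tree_poset t = r"
proof -
  have "r \<in> tree_poset ` {t. distinct (leaves t) \<and> set (leaves t) = A}"
    unfolding WN_eq_tree_posets[OF assms(2), symmetric] using assms(1) by simp
  then show thesis
    using that by blast
qed

lemma set_operad_WN:
  "set_operad (\<lambda>A. {r. WN A r}) (\<lambda>A \<sigma> r. map_prod \<sigma> \<sigma> ` r) poset_pcomp (\<lambda>a. {(a, a)})"
proof (rule set_operad_subset[OF poset.set_operad_axioms])
  show "{r. WN A r} \<subseteq> {r. partial_order_on A r}" for A
    by (auto simp: WN_def)
next
  fix A r and \<sigma> :: "nat \<Rightarrow> nat"
  assume A: "label_set A" "inj_on \<sigma> A" and "r \<in> {r. WN A r}"
  then obtain t where t: "distinct (leaves t)" "set (leaves t) = A" "tree_poset t = r"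
    by (auto elim: WN_treeE)
  then show "map_prod \<sigma> \<sigma> ` r \<in> {r. WN (\<sigma> ` A) r}"
    using WN_tree_poset[of "map_leaves \<sigma> t"] A by (simp add: tree_poset_map_leaves distinct_map)
next
  show "{(a, a)} \<in> {r. WN {a} r}" for a
    using WN_tree_poset[of "Leaf a"] by simp
next
  fix A B a r s
  assume AB: "label_set A" "label_set B" "A \<inter> B = {}" "a \<in> A" and "r \<in> {r. WN A r}" "s \<in> {r. WN B r}"
  then obtain t u where t: "distinct (leaves t)" "set (leaves t) = A" "tree_poset t = r"
    and u: "distinct (leaves u)" "set (leaves u) = B" "tree_poset u = s"
    by (auto elim!: WN_treeE)
  then show "poset_pcomp A B a r s \<in> {r. WN (A - {a} \<union> B) r}"
    using WN_tree_poset[of "graft a t u"] AB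
    by (simp add: distinct_leaves_graft set_leaves_graft tree_poset_graft)
qed

lemma WNP_eq: "WNP A = {f. Poly_Mapping.keys f \<subseteq> {r. WN A r}}"
  unfolding WNP_def supported_on_eq_span ..

lemma WNP_operad_eq:
  "WNP_operad =
    linearization (\<lambda>A. {r. WN A r}) (\<lambda>A \<sigma> r. map_prod \<sigma> \<sigma> ` r) poset_pcomp (\<lambda>a. {(a, a)})"
  by (simp add: WNP_operad_def poset_operad_def linearization_def WNP_eq fun_eq_iff)

definition poset_hom :: "((generator, nat) btree \<Rightarrow>\<^sub>0 'k::field) \<Rightarrow> nat rel \<Rightarrow>\<^sub>0 'k" where
  "poset_hom = lin_ext (\<lambda>t. basis_elem (tree_poset t))"

lemma operad_hom_poset_hom: "operad_hom free_operad WNP_operad (\<lambda>A. poset_hom)"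
  unfolding free_operad_def WNP_operad_eq poset_hom_def
  by (rule operad_hom_lin_ext[OF tree.set_operad_axioms set_operad_WN])
    (auto simp: WN_tree_poset tree_poset_map_leaves tree_poset_graft)


section \<open>The relations\<close>

lemma free_operad_sel:
  "comps free_operad A = {f. Poly_Mapping.keys f \<subseteq> {t. distinct (leaves t) \<and> set (leaves t) = A}}"
  "scale free_operad = pm_scale"
  "relabel free_operad A \<sigma> = lin_ext (\<lambda>t. basis_elem (map_leaves \<sigma> t))"
  "pcomp free_operad A B a = bilin_ext (graft a)"
  by (simp_all add: free_operad_def)

text \<open>Evaluates the standard compositions: the auxiliary label 0 disappears by grafting, and
  the associativity relations of both generators become one family, matching the rule
  \<open>assoc\<close> of \<open>tree_eq\<close>.\<close>

lemma WNP_relations_eq: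
  "WNP_relations =
    {({1..2}, basis_elem (Node M (Leaf 2) (Leaf 1)) - basis_elem (Node M (Leaf 1) (Leaf 2)))} \<union>
    (\<lambda>g. ({1..3}, basis_elem (Node g (Node g (Leaf 1) (Leaf 2)) (Leaf 3)) -
       basis_elem (Node g (Leaf 1) (Node g (Leaf 2) (Leaf 3))))) ` UNIV"
proof -
  have UNIV_eq: "(UNIV :: generator set) = {M, Down}"
    using generator.exhaust by auto
  show ?thesis
    unfolding UNIV_eq
    by (simp add: WNP_relations_def Let_def std_pcomp_def free_operad_sel free_gen_def
        numeral_2_eq_2 numeral_3_eq_3 insert_commute)
qed

section \<open>Congruence modulo an ideal containing the relations\<close>

text \<open>The generated ideal is an intersection, so membership in it is proved for an arbitrary
  ideal that contains the relations.\<close>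

locale WNP_ideal =
  fixes I :: "nat set \<Rightarrow> ((generator, nat) btree \<Rightarrow>\<^sub>0 'k::field) set"
  assumes ideal: "operad_ideal free_operad I"
    and relations: "\<And>B x. (B, x) \<in> WNP_relations \<Longrightarrow> x \<in> I B"
begin

definition eqv :: "nat set \<Rightarrow> (generator, nat) btree \<Rightarrow> (generator, nat) btree \<Rightarrow> bool" where
  "eqv A s t \<longleftrightarrow> basis_elem s - basis_elem t \<in> I A"

lemma subspace_I: "label_set A \<Longrightarrow> pm.subspace (I A)"
  using ideal by (simp add: operad_ideal_def free_operad_sel)

lemma eqv_refl: "label_set A \<Longrightarrow> eqv A t t"
  by (simp add: eqv_def pm.subspace_0 subspace_I)

lemma eqv_sym: "label_set A \<Longrightarrow> eqv A s t \<Longrightarrow> eqv A t s"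
  using pm.subspace_neg[OF subspace_I] by (fastforce simp: eqv_def)

lemma eqv_trans: "label_set A \<Longrightarrow> eqv A s t \<Longrightarrow> eqv A t u \<Longrightarrow> eqv A s u"
  using pm.subspace_add[OF subspace_I] by (fastforce simp: eqv_def)

lemma eqv_map_leaves:
  assumes "label_set A" "inj_on \<sigma> A" "eqv A s t"
  shows "eqv (\<sigma> ` A) (map_leaves \<sigma> s) (map_leaves \<sigma> t)"
proof -
  have "relabel free_operad A \<sigma> (basis_elem s - basis_elem t) \<in> I (\<sigma> ` A)"
    using ideal assms unfolding operad_ideal_def eqv_def by blast
  then show ?thesis
    by (simp add: eqv_def free_operad_sel)
qed

lemma eqv_graft_left:
  assumes "label_set A" "a \<in> A" "distinct (leaves u)" "A \<inter> set (leaves u) = {}" "eqv A s t"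
  shows "eqv (A - {a} \<union> set (leaves u)) (graft a s u) (graft a t u)"
proof -
  have "basis_elem u \<in> comps (free_operad :: ('k, (generator, nat) btree \<Rightarrow>\<^sub>0 'k) operad_data)
      (set (leaves u))"
    using assms(3) by (simp add: free_operad_sel)
  then have "pcomp free_operad A (set (leaves u)) a (basis_elem s - basis_elem t) (basis_elem u)
      \<in> I (A - {a} \<union> set (leaves u))"
    using ideal assms unfolding operad_ideal_def eqv_def by (metis List.finite_set set_leaves_not_empty)
  then show ?thesis
    by (simp add: eqv_def free_operad_sel)
qed

lemma eqv_graft_right:
  assumes "label_set B" "distinct (leaves u)" "a \<in> set (leaves u)" "set (leaves u) \<inter> B = {}" "eqv B s t"
  shows "eqv (set (leaves u) - {a} \<union> B) (graft a u s) (graft a u t)"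
proof -
  have "basis_elem u \<in> comps (free_operad :: ('k, (generator, nat) btree \<Rightarrow>\<^sub>0 'k) operad_data)
      (set (leaves u))"
    using assms(2) by (simp add: free_operad_sel)
  then have "pcomp free_operad (set (leaves u)) B a (basis_elem u) (basis_elem s - basis_elem t)
      \<in> I (set (leaves u) - {a} \<union> B)"
    using ideal assms unfolding operad_ideal_def eqv_def by (metis List.finite_set set_leaves_not_empty)
  then show ?thesis
    by (simp add: eqv_def free_operad_sel)
qed

text \<open>An ideal is closed under composition at a leaf only. Each child is thus seen as grafted
  onto a fresh leaf \<open>a\<close>, and the two children are replaced one after the other.\<close>

lemma eqv_cong:
  assumes "distinct (leaves (Node g s t))" "distinct (leaves s')"
    and "set (leaves s') = set (leaves s)"
    and s: "eqv (set (leaves s)) s s'" and t: "eqv (set (leaves t)) t t'"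
    and "set (leaves t') = set (leaves t)"
  shows "eqv (set (leaves (Node g s t))) (Node g s t) (Node g s' t')"
proof -
  let ?S = "set (leaves s)" and ?T = "set (leaves t)"
  have disj: "?S \<inter> ?T = {}"
    using assms(1) by auto
  obtain a where a: "a \<notin> ?S \<union> ?T"
    using ex_new_if_finite[of "?S \<union> ?T"] by auto
  have "eqv (set (leaves (Node g (Leaf a) t)) - {a} \<union> ?S)
      (graft a (Node g (Leaf a) t) s) (graft a (Node g (Leaf a) t) s')"
    by (rule eqv_graft_right) (use assms a in auto)
  moreover have "eqv (set (leaves (Node g s' (Leaf a))) - {a} \<union> ?T)
      (graft a (Node g s' (Leaf a)) t) (graft a (Node g s' (Leaf a)) t')"
    by (rule eqv_graft_right) (use assms a in auto)
  moreover have "set (leaves (Node g (Leaf a) t)) - {a} \<union> ?S = ?S \<union> ?T"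
      "set (leaves (Node g s' (Leaf a))) - {a} \<union> ?T = ?S \<union> ?T"
    using a assms(3) by auto
  ultimately show ?thesis
    using a assms(3) eqv_trans[of "?S \<union> ?T"] by (simp add: graft_no_leaf)
qed

text \<open>The relation is moved to two fresh leaves, onto which \<open>s\<close> and
  \<open>t\<close> are then grafted. Freshness keeps the labels disjoint during the intermediate
  stage in which only \<open>s\<close> is in place.\<close>

lemma eqv_comm:
  assumes "distinct (leaves (Node M s t))"
  shows "eqv (set (leaves (Node M s t))) (Node M s t) (Node M t s)"
proof -
  let ?S = "set (leaves s)" and ?T = "set (leaves t)"
  have disj: "?S \<inter> ?T = {}" "distinct (leaves s)" "distinct (leaves t)"
    using assms by auto
  obtain a where a: "a \<notin> ?S \<union> ?T"
    using ex_new_if_finite[of "?S \<union> ?T"] by auto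
  obtain b where b: "b \<notin> insert a (?S \<union> ?T)"
    using ex_new_if_finite[of "insert a (?S \<union> ?T)"] by auto
  \<comment> \<open>The label 2 goes to \<open>a\<close> because the left tree of the relation has
    the leaf 2 first.\<close>
  define \<sigma> where "\<sigma> = (\<lambda>i::nat. if i = 2 then a else b)"
  have two: "{1..2} = {1, 2::nat}"
    by auto
  have "eqv {1..2} (Node M (Leaf 2) (Leaf 1)) (Node M (Leaf 1) (Leaf 2))"
    unfolding eqv_def by (rule relations) (simp add: WNP_relations_eq)
  then have "eqv {1, 2} (Node M (Leaf 2) (Leaf 1)) (Node M (Leaf 1) (Leaf 2))"
    unfolding two .
  moreover have "inj_on \<sigma> {1, 2}"
    using b by (auto simp: \<sigma>_def inj_on_def)
  ultimately have "eqv (\<sigma> ` {1, 2}) (map_leaves \<sigma> (Node M (Leaf 2) (Leaf 1)))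
      (map_leaves \<sigma> (Node M (Leaf 1) (Leaf 2)))"
    by (intro eqv_map_leaves) simp_all
  then have "eqv {a, b} (Node M (Leaf a) (Leaf b)) (Node M (Leaf b) (Leaf a))"
    by (simp add: \<sigma>_def insert_commute)
  then have "eqv ({a, b} - {a} \<union> ?S) (Node M s (Leaf b)) (Node M (Leaf b) s)"
    using eqv_graft_left[of "{a, b}" a s "Node M (Leaf a) (Leaf b)" "Node M (Leaf b) (Leaf a)"]
      a b disj by simp
  moreover have "{a, b} - {a} \<union> ?S = insert b ?S"
    using b by auto
  ultimately have "eqv (insert b ?S - {b} \<union> ?T) (Node M s t) (Node M t s)"
    using eqv_graft_left[of "insert b ?S" b t "Node M s (Leaf b)" "Node M (Leaf b) s"] a b disj
    by (simp add: graft_no_leaf)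
  moreover have "insert b ?S - {b} \<union> ?T = ?S \<union> ?T"
    using b by auto
  ultimately show ?thesis
    by simp
qed

lemma eqv_assoc:
  assumes "distinct (leaves (Node g (Node g s t) u))"
  shows "eqv (set (leaves (Node g (Node g s t) u))) (Node g (Node g s t) u) (Node g s (Node g t u))"
proof -
  let ?S = "set (leaves s)" and ?T = "set (leaves t)" and ?U = "set (leaves u)"
  have disj: "?S \<inter> ?T = {}" "?S \<inter> ?U = {}" "?T \<inter> ?U = {}"
      "distinct (leaves s)" "distinct (leaves t)" "distinct (leaves u)"
    using assms by auto
  obtain a where a: "a \<notin> ?S \<union> ?T \<union> ?U"
    using ex_new_if_finite[of "?S \<union> ?T \<union> ?U"] by auto
  obtain b where b: "b \<notin> insert a (?S \<union> ?T \<union> ?U)"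
    using ex_new_if_finite[of "insert a (?S \<union> ?T \<union> ?U)"] by auto
  obtain c where c: "c \<notin> insert b (insert a (?S \<union> ?T \<union> ?U))"
    using ex_new_if_finite[of "insert b (insert a (?S \<union> ?T \<union> ?U))"] by auto
  \<comment> \<open>Three fresh leaves in the order of the relation; \<open>s\<close>,
    \<open>t\<close>, \<open>u\<close> are grafted onto \<open>a\<close>, \<open>b\<close>,
    \<open>c\<close> in turn.\<close>
  define \<sigma> where "\<sigma> = (\<lambda>i::nat. if i = 1 then a else if i = 2 then b else c)"
  have three: "{1..3} = {1, 2, 3::nat}"
    by auto
  have "eqv {1..3} (Node g (Node g (Leaf 1) (Leaf 2)) (Leaf 3)) (Node g (Leaf 1) (Node g (Leaf 2) (Leaf 3)))"
    unfolding eqv_def by (rule relations) (simp add: WNP_relations_eq)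
  then have "eqv {1, 2, 3} (Node g (Node g (Leaf 1) (Leaf 2)) (Leaf 3)) (Node g (Leaf 1) (Node g (Leaf 2) (Leaf 3)))"
    unfolding three .
  moreover have "inj_on \<sigma> {1, 2, 3}"
    using b c by (auto simp: \<sigma>_def inj_on_def)
  ultimately have "eqv (\<sigma> ` {1, 2, 3}) (map_leaves \<sigma> (Node g (Node g (Leaf 1) (Leaf 2)) (Leaf 3)))
      (map_leaves \<sigma> (Node g (Leaf 1) (Node g (Leaf 2) (Leaf 3))))"
    by (intro eqv_map_leaves) simp_all
  then have "eqv {a, b, c} (Node g (Node g (Leaf a) (Leaf b)) (Leaf c)) (Node g (Leaf a) (Node g (Leaf b) (Leaf c)))"
    by (simp add: \<sigma>_def insert_commute)
  then have "eqv ({a, b, c} - {a} \<union> ?S) (Node g (Node g s (Leaf b)) (Leaf c)) (Node g s (Node g (Leaf b) (Leaf c)))"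
    using eqv_graft_left[of "{a, b, c}" a s "Node g (Node g (Leaf a) (Leaf b)) (Leaf c)"
        "Node g (Leaf a) (Node g (Leaf b) (Leaf c))"] a b c disj by simp
  moreover have "{a, b, c} - {a} \<union> ?S = insert b (insert c ?S)"
    using b c by auto
  ultimately have "eqv (insert b (insert c ?S) - {b} \<union> ?T) (Node g (Node g s t) (Leaf c)) (Node g s (Node g t (Leaf c)))"
    using eqv_graft_left[of "insert b (insert c ?S)" b t "Node g (Node g s (Leaf b)) (Leaf c)" "Node g s (Node g (Leaf b) (Leaf c))"]
      a b c disj by (simp add: graft_no_leaf)
  moreover have "insert b (insert c ?S) - {b} \<union> ?T = insert c (?S \<union> ?T)"
    using b c by auto
  ultimately have "eqv (insert c (?S \<union> ?T) - {c} \<union> ?U) (Node g (Node g s t) u) (Node g s (Node g t u))"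
    using eqv_graft_left[of "insert c (?S \<union> ?T)" c u "Node g (Node g s t) (Leaf c)" "Node g s (Node g t (Leaf c))"]
      a b c disj by (simp add: graft_no_leaf Int_Un_distrib2)
  moreover have "insert c (?S \<union> ?T) - {c} \<union> ?U = ?S \<union> ?T \<union> ?U"
    using c by auto
  ultimately show ?thesis
    by (simp add: Un_assoc)
qed

lemma tree_eq_eqv: "tree_eq s t \<Longrightarrow> distinct (leaves s) \<Longrightarrow> eqv (set (leaves s)) s t"
proof (induction rule: tree_eq.induct)
  case (sym s t)
  then show ?case
    using tree_eq_leaves[OF sym.hyps] eqv_sym[of "set (leaves s)" s t] by simp
next
  case (trans s t u)
  then show ?case
    using tree_eq_leaves[OF trans.hyps(1)] eqv_trans[of "set (leaves s)" s t u] by simp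
next
  case (cong s s' t t' g)
  then show ?case
    using tree_eq_leaves[OF cong.hyps(1)] tree_eq_leaves[OF cong.hyps(2)]
    by (intro eqv_cong) simp_all
qed (simp_all only: eqv_refl eqv_comm eqv_assoc List.finite_set set_leaves_not_empty not_False_eq_True simp_thms)

end

section \<open>Image and kernel of the morphism from trees to posets\<close>

text \<open>The chosen trees extend linearly to a section of \<open>poset_hom\<close>, which yields
  surjectivity and the normal form used for the kernel.\<close>

lemma poset_hom_section:
  assumes "label_set A"
  obtains \<rho> where "\<And>r. WN A r \<Longrightarrow> distinct (leaves (\<rho> r)) \<and> set (leaves (\<rho> r)) = A \<and> tree_poset (\<rho> r) = r"
proof -
  have "\<forall>r. \<exists>t. WN A r \<longrightarrow> distinct (leaves t) \<and> set (leaves t) = A \<and> tree_poset t = r"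
    using assms by (metis WN_treeE)
  from choice[OF this] show thesis
    using that by blast
qed

lemma poset_hom_image:
  assumes "label_set A"
  shows "poset_hom ` comps free_operad A =
    comps (WNP_operad :: ('k::field, nat rel \<Rightarrow>\<^sub>0 'k) operad_data) A"
proof
  show "poset_hom ` comps free_operad A \<subseteq> comps (WNP_operad :: ('k, nat rel \<Rightarrow>\<^sub>0 'k) operad_data) A"
    using operad_hom_poset_hom[where 'a='k] assms by (simp add: operad_hom_def)
  show "comps (WNP_operad :: ('k, nat rel \<Rightarrow>\<^sub>0 'k) operad_data) A \<subseteq> poset_hom ` comps free_operad A"
  proof
    fix f :: "nat rel \<Rightarrow>\<^sub>0 'k"
    obtain \<rho> where \<rho>: "\<And>r. WN A r \<Longrightarrow> distinct (leaves (\<rho> r)) \<and> set (leaves (\<rho> r)) = A \<and> tree_poset (\<rho> r) = r"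
      using poset_hom_section[OF assms] by blast
    assume "f \<in> comps WNP_operad A"
    then have f: "Poly_Mapping.keys f \<subseteq> {r. WN A r}"
      by (simp add: WNP_operad_eq)
    then have "f = poset_hom (lin_ext (\<lambda>r. basis_elem (\<rho> r)) f)"
      unfolding poset_hom_def by (induction rule: supported_on_induct) (use \<rho> in simp_all)
    moreover have "lin_ext (\<lambda>r. basis_elem (\<rho> r)) f \<in> comps free_operad A"
      using keys_lin_ext_basis[OF f, of \<rho>] \<rho> by (simp add: free_operad_sel)
    ultimately show "f \<in> poset_hom ` comps free_operad A"
      by blast
  qed
qed

lemma poset_hom_kernel:
  assumes "label_set A"
  shows "{f \<in> comps free_operad A. poset_hom f = 0} =
    generated_ideal free_operad (WNP_relations :: (nat set \<times> (_ \<Rightarrow>\<^sub>0 'k::field)) set) A"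
proof
  show "{f \<in> comps free_operad A. poset_hom f = 0} \<subseteq>
      generated_ideal free_operad (WNP_relations :: (nat set \<times> (_ \<Rightarrow>\<^sub>0 'k)) set) A"
  proof
    fix f :: "(generator, nat) btree \<Rightarrow>\<^sub>0 'k"
    assume "f \<in> {f \<in> comps free_operad A. poset_hom f = 0}"
    then have f: "Poly_Mapping.keys f \<subseteq> {t. distinct (leaves t) \<and> set (leaves t) = A}" "poset_hom f = 0"
      by (simp_all add: free_operad_sel)
    obtain \<rho> where \<rho>: "\<And>r. WN A r \<Longrightarrow> distinct (leaves (\<rho> r)) \<and> set (leaves (\<rho> r)) = A \<and> tree_poset (\<rho> r) = r"
      using poset_hom_section[OF assms] by blast
    \<comment> \<open>The section applied after \<open>poset_hom\<close> is subtracted from the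
      identity. On the kernel the subtracted term is zero, so \<open>f\<close> itself is a
      combination of differences of a tree and the chosen tree with the same poset.\<close>
    have "lin_ext (\<lambda>t. basis_elem t - basis_elem (\<rho> (tree_poset t))) f =
        f - lin_ext (\<lambda>r. basis_elem (\<rho> r)) (poset_hom f)"
      unfolding poset_hom_def using f(1)
      by (induction rule: supported_on_induct) (simp_all add: pm.scale_right_diff_distrib)
    then have expand: "f = lin_ext (\<lambda>t. basis_elem t - basis_elem (\<rho> (tree_poset t))) f"
      using f(2) by simp
    have "f \<in> I A" if "operad_ideal free_operad I" "\<forall>(B, x) \<in> WNP_relations. x \<in> I B" for I
    proof -
      interpret WNP_ideal I
        using that by unfold_locales auto
      have "basis_elem t - basis_elem (\<rho> (tree_poset t)) \<in> I A"
        if "t \<in> {t. distinct (leaves t) \<and> set (leaves t) = A}" for t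
      proof -
        have t: "distinct (leaves t)" "set (leaves t) = A"
          using that by auto
        have wn: "WN A (tree_poset t)"
          using WN_tree_poset[OF t(1)] t(2) by simp
        have "represents (tree_poset t) A t" "represents (tree_poset t) A (\<rho> (tree_poset t))"
          using represents_self[OF t(1)] represents_self[of "\<rho> (tree_poset t)"] \<rho>[OF wn] t(2) by auto
        then have "tree_eq t (\<rho> (tree_poset t))"
          using represents_unique[OF wn] assms by blast
        then show ?thesis
          using tree_eq_eqv t by (auto simp: eqv_def)
      qed
      then have "lin_ext (\<lambda>t. basis_elem t - basis_elem (\<rho> (tree_poset t))) f \<in> I A"
        by (rule lin_ext_subspace[OF subspace_I[OF assms] f(1)])
      then show ?thesis
        by (simp flip: expand)
    qed
    then show "f \<in> generated_ideal free_operad WNP_relations A"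
      unfolding generated_ideal_def by blast
  qed
  \<comment> \<open>For the converse the kernel itself takes part in the intersection: it is an
    ideal, and the two trees in each relation have the same poset.\<close>
  have "operad_ideal free_operad (\<lambda>A. {f \<in> comps free_operad A. poset_hom f = (0 :: nat rel \<Rightarrow>\<^sub>0 'k)})"
    using operad_ideal_kernel[OF operad_hom_poset_hom] .
  moreover have "x \<in> {f \<in> comps free_operad B. poset_hom f = 0}"
    if "(B, x) \<in> WNP_relations" for B and x :: "_ \<Rightarrow>\<^sub>0 'k"
  proof -
    have mem: "basis_elem s - basis_elem t \<in> comps (free_operad :: ('k, (generator, nat) btree \<Rightarrow>\<^sub>0 'k) operad_data) B"
      if "distinct (leaves s)" "set (leaves s) = B" "distinct (leaves t)" "set (leaves t) = B"
      for s t :: "(generator, nat) btree" and B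
      using pm.subspace_diff[OF subspace_supported_on[of "{t. distinct (leaves t) \<and> set (leaves t) = B}"],
          of "basis_elem s" "basis_elem t"] that by (simp add: free_operad_sel)
    show ?thesis
      using that unfolding WNP_relations_eq by (auto intro!: mem simp: poset_hom_def insert_commute)
  qed
  ultimately show "generated_ideal free_operad WNP_relations A \<subseteq> {f \<in> comps free_operad A. poset_hom f = (0 :: nat rel \<Rightarrow>\<^sub>0 'k)}"
    unfolding generated_ideal_def by blast
qed

theorem theorem18:
  shows "suboperad (poset_operad :: ('k::field, nat rel \<Rightarrow>\<^sub>0 'k) operad_data) WNP \<and>
         presented_by (WNP_operad :: ('k::field, nat rel \<Rightarrow>\<^sub>0 'k) operad_data) poset_gen WNP_relations"
proof
  show "suboperad (poset_operad :: ('k, nat rel \<Rightarrow>\<^sub>0 'k) operad_data) WNP"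
    unfolding poset_operad_def WNP_eq
    by (rule suboperad_linearization[OF poset.set_operad_axioms set_operad_WN]) (auto simp: WN_def)
  have "poset_hom (free_gen g) = (poset_gen g :: nat rel \<Rightarrow>\<^sub>0 'k)" for g
    by (cases g) (simp_all add: poset_hom_def free_gen_def insert_commute)
  then show "presented_by (WNP_operad :: ('k, nat rel \<Rightarrow>\<^sub>0 'k) operad_data) poset_gen WNP_relations"
    unfolding presented_by_def
    by (intro exI[of _ "\<lambda>A. poset_hom"] conjI allI impI operad_hom_poset_hom poset_hom_image
        poset_hom_kernel) simp_all
qed

end
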